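(* Let $\Gamma_\delta$ be the marked metric graph with four vertices $V_1,V_2,V_3,V_4$ and four edges of lengths $l_1,l_2,l_3,l_4$, where the edge of length $l_1$ joins $V_1$ to $V_2$, the two edges of lengths $l_2$ and $l_3$ both join $V_2$ to $V_3$, and the edge of length $l_4$ joins $V_3$ to $V_4$; the vertices $V_1,V_2$ are of $\delta$ type and the vertices $V_3,V_4$ are of $\delta'$ type. Assume that $l_1,l_2,l_3,l_4$ are rationally independent. Let $A_{\vec\alpha}$ and $A_{\vec{\widetilde\alpha}}$ be two graph Laplacians on $\Gamma_\delta$ with coupling constants $\vec\alpha,\vec{\widetilde\alpha}\in\mathbb R^4$. If the spectra of $A_{\vec\alpha}$ and $A_{\vec{\widetilde\alpha}}$ coincide counting multiplicities, then $\vec\alpha=\vec{\widetilde\alpha}$.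
   Context: A finite compact metric graph $\Gamma$ consists of a finite non-empty collection of compact intervals $\Delta_j=[x_{2j-1},x_{2j}]$, $j=1,\dots,n$ (the edges), together with a partition of the set of endpoints $\{x_k\}_{k=1}^{2n}$ into $N$ classes $V_1,\dots,V_N$ (the vertices). The valence (degree) $\gamma_m=\deg V_m$ is the number of endpoints belonging to $V_m$; a vertex of valence greater than 1 is called internal. Put $L_2(\Gamma)=\bigoplus_{j=1}^n L_2(\Delta_j)$ and $W_2^2(\Gamma)=\bigoplus_{j=1}^n W_2^2(\Delta_j)$ (Sobolev spaces). For $f\in W_2^2(\Gamma)$ the normal derivative at an endpoint is $\partial_n f(x_j)=f'(x_j)$ if $x_j$ is the left endpoint of its edge and $\partial_n f(x_j)=-f'(x_j)$ if it is the right endpoint. Put $f^\Sigma(V_k)=\sum_{x_j\in V_k}f(x_j)$ and $\partial_n^\Sigma f(V_k)=\sum_{x_j\in V_k}\partial_n f(x_j)$. A marked graph $\Gamma_\delta$ is a graph $\Gamma$ in which each vertex is assigned one of the two types $\delta$ or $\delta'$. Let $\mathcal D(\Gamma_\delta)$ be the set of all $f\in W_2^2(\Gamma)$ such that $f(x_i)=f(x_j)$ for all $x_i,x_j\in V$ at every internal vertex $V$ of $\delta$ type, and $\partial_n f(x_i)=\partial_n f(x_j)$ for all $x_i,x_j\in V$ at every internal vertex $V$ of $\delta'$ type. For $\vec\alpha=(\alpha_1,\dots,\alpha_N)\in\mathbb R^N$ (coupling constants), the graph Laplacian $A_{\vec\alpha}$ is the operator in $L_2(\Gamma)$ acting on each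 edge as $-\frac{d^2}{dx^2}$, with domain consisting of all $f\in\mathcal D(\Gamma_\delta)$ such that for every $k$: $\partial_n^\Sigma f(V_k)=\frac{\alpha_k}{\gamma_k}f^\Sigma(V_k)$ if $V_k$ is of $\delta$ type, and $f^\Sigma(V_k)=-\frac{\alpha_k}{\gamma_k}\partial_n^\Sigma f(V_k)$ if $V_k$ is of $\delta'$ type. It is self-adjoint with purely discrete spectrum. Edge lengths are called rationally independent if they are linearly independent over $\mathbb Q$. *)

theory Defs
  imports "HOL-Analysis.Analysis" "HOL-Library.Function_Algebras" "HOL-Library.Disjoint_Sets"
begin

section \<open>Marked metric graphs\<close>

datatype vertex_type = Delta | DeltaPrime

text \<open>
  Edges are numbered from 1 to \<open>num_edges\<close>, vertices from 1 to \<open>num_vertices\<close>; edge \<open>j\<close> is the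
  interval from \<open>endpoint (2 * j - 1)\<close> to \<open>endpoint (2 * j)\<close>.  A vertex is a set of endpoint
  \<^emph>\<open>indices\<close>, because endpoints of different edges are distinct points of the graph even when they
  have the same coordinate on the real line.
\<close>

record marked_graph =
  num_edges :: nat
  endpoint :: "nat \<Rightarrow> real"
  num_vertices :: nat
  vertex :: "nat \<Rightarrow> nat set"
  vertex_type :: "nat \<Rightarrow> vertex_type"

definition metric_graph :: "marked_graph \<Rightarrow> bool" where
  "metric_graph G \<longleftrightarrow>
     num_edges G \<ge> 1 \<and>
     (\<forall>j\<in>{1..num_edges G}. endpoint G (2 * j - 1) < endpoint G (2 * j)) \<and>
     partition_on {1..2 * num_edges G} (vertex G ` {1..num_vertices G}) \<and>
     inj_on (vertex G) {1..num_vertices G}"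

definition edge :: "marked_graph \<Rightarrow> nat \<Rightarrow> real set" where
  "edge G j = {endpoint G (2 * j - 1)..endpoint G (2 * j)}"

definition edge_length :: "marked_graph \<Rightarrow> nat \<Rightarrow> real" where
  "edge_length G j = endpoint G (2 * j) - endpoint G (2 * j - 1)"

definition valence :: "marked_graph \<Rightarrow> nat \<Rightarrow> nat" where
  "valence G m = card (vertex G m)"

definition internal :: "marked_graph \<Rightarrow> nat \<Rightarrow> bool" where
  "internal G m \<longleftrightarrow> valence G m > 1"

definition joins :: "marked_graph \<Rightarrow> nat \<Rightarrow> nat \<Rightarrow> nat \<Rightarrow> bool" where
  "joins G j u v \<longleftrightarrow>
     2 * j - 1 \<in> vertex G u \<and> 2 * j \<in> vertex G v \<or>
     2 * j - 1 \<in> vertex G v \<and> 2 * j \<in> vertex G u"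

definition rationally_independent :: "nat set \<Rightarrow> (nat \<Rightarrow> real) \<Rightarrow> bool" where
  "rationally_independent I l \<longleftrightarrow>
     (\<forall>q :: nat \<Rightarrow> rat. (\<Sum>i\<in>I. of_rat (q i) * l i) = 0 \<longrightarrow> (\<forall>i\<in>I. q i = 0))"


section \<open>Function spaces\<close>

text \<open>A function on the graph; the value at the point \<open>x\<close> of edge \<open>j\<close> is \<open>f j x\<close>.\<close>

type_synonym gfun = "nat \<Rightarrow> real \<Rightarrow> complex"

definition square_integrable_on :: "(real \<Rightarrow> complex) \<Rightarrow> real set \<Rightarrow> bool"
  (infix \<open>square'_integrable'_on\<close> 50) where
  "g square_integrable_on S \<longleftrightarrow>
     set_borel_measurable lebesgue S g \<and> set_integrable lebesgue S (\<lambda>x. (cmod (g x))\<^sup>2)"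

text \<open>
  \<open>f\<close> is the continuously differentiable representative of an element of \<open>W\<^sub>2\<^sup>2[a,b]\<close>, and \<open>h\<close> is a
  representative of its second derivative: \<open>f'\<close> is absolutely continuous with \<open>f'' = h\<close> almost
  everywhere and \<open>h\<close> in \<open>L\<^sub>2\<close>.  At \<open>a\<close> and \<open>b\<close> the derivatives are one-sided.
\<close>

definition has_L2_second_derivative ::
    "(real \<Rightarrow> complex) \<Rightarrow> (real \<Rightarrow> complex) \<Rightarrow> real \<Rightarrow> real \<Rightarrow> bool" where
  "has_L2_second_derivative f h a b \<longleftrightarrow>
     f differentiable_on {a..b} \<and> h square_integrable_on {a..b} \<and>
     (\<forall>x\<in>{a..b}. vector_derivative f (at x within {a..b}) =
        vector_derivative f (at a within {a..b}) + (LINT t:{a..x}|lebesgue. h t))"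

text \<open>
  Elements of \<open>L\<^sub>2(\<Gamma>)\<close> are represented by functions, with almost everywhere equal functions
  standing for the same element.  Elements of \<open>W\<^sub>2\<^sup>2(\<Gamma>)\<close> are represented by their continuous
  representatives, extended by 0 off the graph, so that on this set equality of elements is
  equality of functions.
\<close>

definition L2_graph :: "marked_graph \<Rightarrow> gfun set" where
  "L2_graph G = {g. \<forall>j\<in>{1..num_edges G}. g j square_integrable_on edge G j}"

definition L2_norm_graph :: "marked_graph \<Rightarrow> gfun \<Rightarrow> real" where
  "L2_norm_graph G g =
     sqrt (\<Sum>j=1..num_edges G. LINT x:edge G j|lebesgue. (cmod (g j x))\<^sup>2)"

definition W22_graph :: "marked_graph \<Rightarrow> gfun set" where
  "W22_graph G = {f.
     (\<forall>j\<in>{1..num_edges G}.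
        \<exists>h. has_L2_second_derivative (f j) h (endpoint G (2 * j - 1)) (endpoint G (2 * j))) \<and>
     (\<forall>j x. j \<notin> {1..num_edges G} \<or> x \<notin> edge G j \<longrightarrow> f j x = 0)}"

text \<open>Endpoint \<open>i\<close> belongs to edge \<open>(i + 1) div 2\<close>, and is its left endpoint iff \<open>i\<close> is odd.\<close>

definition endpoint_edge :: "nat \<Rightarrow> nat" where
  "endpoint_edge i = (i + 1) div 2"

definition endpoint_value :: "marked_graph \<Rightarrow> gfun \<Rightarrow> nat \<Rightarrow> complex" where
  "endpoint_value G f i = f (endpoint_edge i) (endpoint G i)"

definition normal_derivative :: "marked_graph \<Rightarrow> gfun \<Rightarrow> nat \<Rightarrow> complex" where
  "normal_derivative G f i =
     (if odd i then 1 else -1) *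
     vector_derivative (f (endpoint_edge i)) (at (endpoint G i) within edge G (endpoint_edge i))"

definition vertex_sum :: "marked_graph \<Rightarrow> gfun \<Rightarrow> nat \<Rightarrow> complex" where
  "vertex_sum G f k = (\<Sum>i\<in>vertex G k. endpoint_value G f i)"

definition normal_derivative_sum :: "marked_graph \<Rightarrow> gfun \<Rightarrow> nat \<Rightarrow> complex" where
  "normal_derivative_sum G f k = (\<Sum>i\<in>vertex G k. normal_derivative G f i)"


section \<open>The graph Laplacian and its spectrum\<close>

definition matching_domain :: "marked_graph \<Rightarrow> gfun set" where
  "matching_domain G = {f \<in> W22_graph G.
     \<forall>m\<in>{1..num_vertices G}. internal G m \<longrightarrow>
       (case vertex_type G m of
          Delta \<Rightarrow> \<forall>i\<in>vertex G m. \<forall>j\<in>vertex G m. endpoint_value G f i = endpoint_value G f j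
        | DeltaPrime \<Rightarrow>
            \<forall>i\<in>vertex G m. \<forall>j\<in>vertex G m. normal_derivative G f i = normal_derivative G f j)}"

definition laplacian_domain :: "marked_graph \<Rightarrow> (nat \<Rightarrow> real) \<Rightarrow> gfun set" where
  "laplacian_domain G \<alpha> = {f \<in> matching_domain G.
     \<forall>k\<in>{1..num_vertices G}.
       (case vertex_type G k of
          Delta \<Rightarrow>
            normal_derivative_sum G f k = of_real (\<alpha> k / valence G k) * vertex_sum G f k
        | DeltaPrime \<Rightarrow>
            vertex_sum G f k = - of_real (\<alpha> k / valence G k) * normal_derivative_sum G f k)}"

text \<open>
  The operator as a graph: \<open>(f, g)\<close> belongs to it iff \<open>f\<close> is in the domain and \<open>g\<close> is one of the
  almost everywhere equal representatives of the image \<open>-f''\<close>.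
\<close>

definition laplacian :: "marked_graph \<Rightarrow> (nat \<Rightarrow> real) \<Rightarrow> (gfun \<times> gfun) set" where
  "laplacian G \<alpha> = {(f, g). f \<in> laplacian_domain G \<alpha> \<and>
     (\<forall>j\<in>{1..num_edges G}.
        has_L2_second_derivative (f j) (\<lambda>x. - g j x)
          (endpoint G (2 * j - 1)) (endpoint G (2 * j)))}"

definition gscale :: "complex \<Rightarrow> gfun \<Rightarrow> gfun" where
  "gscale c f = (\<lambda>j x. c * f j x)"

global_interpretation gfun: vector_space gscale
  defines gfun_dim = gfun.dim
  by unfold_locales (auto simp: gscale_def fun_eq_iff algebra_simps)

text \<open>The resolvent set: \<open>A - \<mu>\<close> is a bijection from the domain onto \<open>L\<^sub>2(\<Gamma>)\<close> with bounded inverse.\<close>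

definition resolvent_set :: "marked_graph \<Rightarrow> (nat \<Rightarrow> real) \<Rightarrow> complex set" where
  "resolvent_set G \<alpha> = {\<mu>.
     (\<forall>g\<in>L2_graph G. \<exists>!f. (f, g + gscale \<mu> f) \<in> laplacian G \<alpha>) \<and>
     (\<exists>C. \<forall>f g. (f, g + gscale \<mu> f) \<in> laplacian G \<alpha> \<longrightarrow> L2_norm_graph G f \<le> C * L2_norm_graph G g)}"

definition laplacian_spectrum :: "marked_graph \<Rightarrow> (nat \<Rightarrow> real) \<Rightarrow> complex set" where
  "laplacian_spectrum G \<alpha> = - resolvent_set G \<alpha>"

definition eigenspace :: "marked_graph \<Rightarrow> (nat \<Rightarrow> real) \<Rightarrow> complex \<Rightarrow> gfun set" where
  "eigenspace G \<alpha> \<mu> = {f. (f, gscale \<mu> f) \<in> laplacian G \<alpha>}"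

text \<open>
  The eigenspaces are finite-dimensional, since on each edge the solutions of \<open>-f'' = \<mu> f\<close> form a
  two-dimensional space; so the convention that \<open>dim\<close> is 0 for infinite-dimensional spaces is
  harmless.
\<close>

definition multiplicity_in_spectrum :: "marked_graph \<Rightarrow> (nat \<Rightarrow> real) \<Rightarrow> complex \<Rightarrow> nat" where
  "multiplicity_in_spectrum G \<alpha> \<mu> = gfun_dim (eigenspace G \<alpha> \<mu>)"

definition isospectral :: "marked_graph \<Rightarrow> (nat \<Rightarrow> real) \<Rightarrow> (nat \<Rightarrow> real) \<Rightarrow> bool" where
  "isospectral G \<alpha> \<beta> \<longleftrightarrow>
     laplacian_spectrum G \<alpha> = laplacian_spectrum G \<beta> \<and>
     (\<forall>\<mu>\<in>laplacian_spectrum G \<alpha>.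
        multiplicity_in_spectrum G \<alpha> \<mu> = multiplicity_in_spectrum G \<beta> \<mu>)"

end

theory Submission
  imports Defs
begin

text \<open>
  Why the coupling constants can be read off from the spectrum.  On each edge an eigenfunction for
  the eigenvalue \<open>k\<^sup>2\<close> is a sinusoid of frequency \<open>k\<close>, so the vertex conditions become a finite
  linear system whose coefficients depend on \<open>1 / k\<close> and, with period \<open>2 \<pi>\<close>, on the phases \<open>k l\<^sub>j\<close>.
  Hence, away from the zeros of \<open>cos (k l\<^sub>2)\<close> and \<open>cos (k l\<^sub>3)\<close>, \<open>k\<^sup>2\<close> is an eigenvalue iff a secular
  function \<open>F (1 / k) (k l)\<close> vanishes (\<open>eigenvalue_iff_secular_zero\<close>).

  Because the lengths are rationally independent, the line \<open>k \<mapsto> k l\<close> is dense in the torus of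
  phases, even for large \<open>k\<close> (\<open>kronecker_flow\<close>).  Near each transversal zero \<open>y\<close> of the leading term
  \<open>F 0\<close> there are therefore eigenvalues with \<open>k\<close> arbitrarily large and phases close to \<open>y\<close>
  (\<open>zeros_along_flow\<close>).  For isospectral operators both secular functions vanish there, so their
  leading terms have common zeros, and at these zeros the corrections of order \<open>1 / k\<close> agree
  (\<open>secular_comparison\<close>).

  The correction is linear in \<open>\<alpha>\<^sub>1\<close>, \<open>\<alpha>\<^sub>2\<close> and, at the \<open>\<delta>'\<close> vertices, in \<open>1 / \<alpha>\<^sub>3\<close>, \<open>1 / \<alpha>\<^sub>4\<close>: at high
  energy a \<open>\<delta>'\<close> condition with \<open>\<alpha> \<noteq> 0\<close> is a perturbed Neumann condition, whereas \<open>\<alpha> = 0\<close> gives a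
  Dirichlet condition and changes the leading term itself.  The leading term tells these cases
  apart, and the corrections at a handful of phases determine the four numbers
  (\<open>coupling_constants_determined\<close>).
\<close>

section \<open>The Helmholtz equation on an interval\<close>

text \<open>
  The definition of \<open>has_L2_second_derivative\<close> is an integral equation for \<open>f'\<close>; as \<open>f\<close> is
  continuous, it makes \<open>f\<close> a classical solution of \<open>f'' = - k\<^sup>2 f\<close>, which is determined by its
  data at the left endpoint.
\<close>

lemma helmholtz_on_interval:
  fixes f :: "real \<Rightarrow> complex"
  assumes "a < b" "k > 0"
    and f: "has_L2_second_derivative f (\<lambda>x. - (of_real (k\<^sup>2) * f x)) a b"
    and x: "x \<in> {a..b}"
  defines "f' \<equiv> \<lambda>x. vector_derivative f (at x within {a..b})"
  shows "f x = of_real (cos (k * (x - a))) * f a + of_real (sin (k * (x - a))) * (f' a / of_real k)"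
    and "f' x / of_real k = of_real (cos (k * (x - a))) * (f' a / of_real k) - of_real (sin (k * (x - a))) * f a"
proof -
  have diff: "f differentiable_on {a..b}"
    and f': "\<And>x. x \<in> {a..b} \<Longrightarrow> f' x = f' a + (LINT t:{a..x}|lebesgue. - (of_real (k\<^sup>2) * f t))"
    using f unfolding has_L2_second_derivative_def f'_def by blast+
  have df: "(f has_vector_derivative f' x) (at x within {a..b})" if "x \<in> {a..b}" for x
    using diff that unfolding f'_def by (simp add: differentiable_on_def vector_derivative_works)
  define h where "h = (\<lambda>x. - (of_real (k\<^sup>2) * f x))"
  have h: "continuous_on {a..b} h"
    unfolding h_def by (intro continuous_intros differentiable_imp_continuous_on diff)
  have f'_eq: "f' x = f' a + integral {a..x} h" if "x \<in> {a..b}" for x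
  proof -
    have "h absolutely_integrable_on {a..x}"
      by (rule absolutely_integrable_continuous_real) (use that in \<open>auto intro: continuous_on_subset[OF h]\<close>)
    then have "(LINT t:{a..x}|lebesgue. h t) = integral {a..x} h"
      by (rule set_lebesgue_integral_eq_integral)
    with f'[OF that] show ?thesis by (simp add: h_def)
  qed
  have df': "(f' has_vector_derivative h x) (at x within {a..b})" if "x \<in> {a..b}" for x
  proof (rule has_vector_derivative_transform[OF that f'_eq])
    show "((\<lambda>x. f' a + integral {a..x} h) has_vector_derivative h x) (at x within {a..b})"
      by (auto intro!: derivative_eq_intros integral_has_vector_derivative[OF h that])
  qed
  \<comment> \<open>Rotating the phase vector \<open>(f, f' / k)\<close> back by the angle \<open>k (x - a)\<close> gives a constant vector.\<close>
  define p where "p = (\<lambda>x. cos (k * (x - a)) *\<^sub>R f x - (sin (k * (x - a)) / k) *\<^sub>R f' x)"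
  define q where "q = (\<lambda>x. sin (k * (x - a)) *\<^sub>R f x + (cos (k * (x - a)) / k) *\<^sub>R f' x)"
  have dp: "(p has_vector_derivative 0) (at x within {a..b})"
    and dq: "(q has_vector_derivative 0) (at x within {a..b})" if "x \<in> {a..b}" for x
    unfolding p_def q_def using \<open>k > 0\<close>
    by (auto intro!: derivative_eq_intros df[OF that] df'[OF that]
        simp: h_def power2_eq_square scaleR_conv_of_real field_simps)
  have const: "g x = g a" if "\<And>x. x \<in> {a..b} \<Longrightarrow> (g has_vector_derivative 0) (at x within {a..b})"
    for g :: "real \<Rightarrow> complex"
  proof -
    have "\<exists>c. \<forall>x\<in>{a..b}. g x = c"
      using that by (intro has_derivative_zero_constant) (auto simp: has_vector_derivative_def)
    then show ?thesis using x \<open>a < b\<close> by auto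
  qed
  have p: "p x = f a" and q: "q x = f' a / of_real k"
    using const[OF dp] const[OF dq] by (simp_all add: p_def q_def scaleR_conv_of_real field_simps)
  define c s where "c = complex_of_real (cos (k * (x - a)))" and "s = complex_of_real (sin (k * (x - a)))"
  have cs: "c * c + s * s = 1"
    by (metis c_def s_def of_real_1 of_real_add of_real_mult sin_cos_squared_add3)
  define F where "F = f' x / of_real k"
  have pq: "c * f x - s * F = f a" "s * f x + c * F = f' a / of_real k"
    using p q by (simp_all add: F_def p_def q_def c_def s_def scaleR_conv_of_real)
  have "c * f a + s * (f' a / of_real k) = (c * c + s * s) * f x"
    "c * (f' a / of_real k) - s * f a = (c * c + s * s) * F"
    unfolding pq[symmetric] by (simp_all add: algebra_simps)
  then show "f x = of_real (cos (k * (x - a))) * f a + of_real (sin (k * (x - a))) * (f' a / of_real k)"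
    "f' x / of_real k = of_real (cos (k * (x - a))) * (f' a / of_real k) - of_real (sin (k * (x - a))) * f a"
    by (simp_all add: cs F_def flip: c_def s_def)
qed

lemma helmholtz_on_interval_exists:
  fixes f :: "real \<Rightarrow> complex"
  assumes "a < b" "k > 0"
    and f: "\<And>x. x \<in> {a..b} \<Longrightarrow> f x = of_real (cos (k * (x - a))) * v + of_real (sin (k * (x - a))) * w"
  shows "has_L2_second_derivative f (\<lambda>x. - (of_real (k\<^sup>2) * f x)) a b"
    and "vector_derivative f (at a within {a..b}) = of_real k * w"
proof -
  define g where "g = (\<lambda>x. of_real (cos (k * (x - a))) * v + of_real (sin (k * (x - a))) * w)"
  define g' where "g' = (\<lambda>x. of_real k * (of_real (cos (k * (x - a))) * w - of_real (sin (k * (x - a))) * v))"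
  define h where "h = (\<lambda>x. - (of_real (k\<^sup>2) * f x))"
  have dg: "(f has_vector_derivative g' x) (at x within {a..b})" if "x \<in> {a..b}" for x
  proof (rule has_vector_derivative_transform[OF that])
    show "f x = g x" if "x \<in> {a..b}" for x using f[OF that] by (simp add: g_def)
    show "(g has_vector_derivative g' x) (at x within {a..b})"
      unfolding g_def g'_def
      by (auto intro!: derivative_eq_intros simp: algebra_simps scaleR_conv_of_real has_vector_derivative_of_real)
  qed
  have f': "vector_derivative f (at x within {a..b}) = g' x" if "x \<in> {a..b}" for x
    using vector_derivative_within_cbox[of a b x f "g' x"] dg[OF that] that \<open>a < b\<close> by simp
  have dg': "(g' has_vector_derivative h x) (at x within {a..b})" if "x \<in> {a..b}" for x
    unfolding g'_def h_def f[OF that]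
    by (auto intro!: derivative_eq_intros simp: algebra_simps power2_eq_square scaleR_conv_of_real)
  have cont: "continuous_on {a..b} f"
    using dg by (rule continuous_on_vector_derivative)
  have h: "continuous_on {a..b} h" unfolding h_def by (intro continuous_intros cont)
  have sq: "h square_integrable_on {a..b}"
    unfolding square_integrable_on_def
  proof
    have "set_integrable lebesgue {a..b} h" by (rule absolutely_integrable_continuous_real[OF h])
    then show "set_borel_measurable lebesgue {a..b} h"
      by (simp add: set_integrable_def set_borel_measurable_def borel_measurable_integrable)
    show "set_integrable lebesgue {a..b} (\<lambda>x. (cmod (h x))\<^sup>2)"
      by (rule absolutely_integrable_continuous_real) (intro continuous_intros h)
  qed
  have "g' x = g' a + (LINT t:{a..x}|lebesgue. h t)" if "x \<in> {a..b}" for x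
  proof -
    have "h absolutely_integrable_on {a..x}"
      by (rule absolutely_integrable_continuous_real) (use that in \<open>auto intro: continuous_on_subset[OF h]\<close>)
    then have "(LINT t:{a..x}|lebesgue. h t) = integral {a..x} h"
      by (rule set_lebesgue_integral_eq_integral)
    also have "\<dots> = g' x - g' a"
      using that by (intro integral_unique fundamental_theorem_of_calculus)
        (auto intro: has_vector_derivative_within_subset[OF dg'])
    finally show ?thesis by simp
  qed
  then have "vector_derivative f (at x within {a..b})
      = vector_derivative f (at a within {a..b}) + (LINT t:{a..x}|lebesgue. h t)" if "x \<in> {a..b}" for x
    unfolding f'[OF that] using f'[of a] that \<open>a < b\<close> by (metis atLeastAtMost_iff order_refl less_imp_le)
  moreover have "f differentiable_on {a..b}"
    unfolding differentiable_on_def using differentiableI_vector[OF dg] by blast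
  ultimately show "has_L2_second_derivative f (\<lambda>x. - (of_real (k\<^sup>2) * f x)) a b"
    using sq unfolding has_L2_second_derivative_def h_def by blast
  show "vector_derivative f (at a within {a..b}) = of_real k * w"
    using f'[of a] \<open>a < b\<close> by (simp add: g'_def)
qed

section \<open>Solutions and eigenvalues on a metric graph\<close>

definition helmholtz :: "marked_graph \<Rightarrow> real \<Rightarrow> gfun \<Rightarrow> bool" where
  "helmholtz G k f \<longleftrightarrow>
     (\<forall>j\<in>{1..num_edges G}. has_L2_second_derivative (f j) (\<lambda>x. - (of_real (k\<^sup>2) * f j x))
        (endpoint G (2 * j - 1)) (endpoint G (2 * j))) \<and>
     (\<forall>j x. j \<notin> {1..num_edges G} \<or> x \<notin> edge G j \<longrightarrow> f j x = 0)"

definition ends_of_edge :: "nat \<Rightarrow> nat \<Rightarrow> nat \<Rightarrow> bool" where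
  "ends_of_edge j i i' \<longleftrightarrow> (i, i') = (2 * j - 1, 2 * j) \<or> (i, i') = (2 * j, 2 * j - 1)"

lemma edge_endpoints_less:
  assumes "metric_graph G" "j \<in> {1..num_edges G}"
  shows "endpoint G (2 * j - 1) < endpoint G (2 * j)"
  using assms by (auto simp: metric_graph_def)

lemma endpoint_edge_simps:
  "j \<ge> 1 \<Longrightarrow> endpoint_edge (2 * j - 1) = j" "Suc 0 \<le> j \<Longrightarrow> endpoint_edge (2 * j - Suc 0) = j"
  "endpoint_edge (2 * j) = j"
  by (auto simp: endpoint_edge_def)

lemma helmholtz_on_edge:
  assumes G: "metric_graph G" and "k > 0" and f: "helmholtz G k f" and j: "j \<in> {1..num_edges G}"
    and x: "x \<in> edge G j"
  defines "a \<equiv> endpoint G (2 * j - 1)"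
  shows "f j x = of_real (cos (k * (x - a))) * endpoint_value G f (2 * j - 1)
      + of_real (sin (k * (x - a))) * (normal_derivative G f (2 * j - 1) / of_real k)"
    and "vector_derivative (f j) (at x within edge G j) / of_real k
      = of_real (cos (k * (x - a))) * (normal_derivative G f (2 * j - 1) / of_real k)
      - of_real (sin (k * (x - a))) * endpoint_value G f (2 * j - 1)"
proof -
  have H: "has_L2_second_derivative (f j) (\<lambda>x. - (of_real (k\<^sup>2) * f j x)) a (endpoint G (2 * j))"
    using f j by (auto simp: helmholtz_def a_def)
  have eq: "endpoint_value G f (2 * j - 1) = f j a"
    "normal_derivative G f (2 * j - 1) = vector_derivative (f j) (at a within {a..endpoint G (2 * j)})"
    using j by (auto simp: endpoint_value_def normal_derivative_def endpoint_edge_simps a_def edge_def)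
  show "f j x = of_real (cos (k * (x - a))) * endpoint_value G f (2 * j - 1)
      + of_real (sin (k * (x - a))) * (normal_derivative G f (2 * j - 1) / of_real k)"
    "vector_derivative (f j) (at x within edge G j) / of_real k
      = of_real (cos (k * (x - a))) * (normal_derivative G f (2 * j - 1) / of_real k)
      - of_real (sin (k * (x - a))) * endpoint_value G f (2 * j - 1)"
    using helmholtz_on_interval[OF _ \<open>k > 0\<close> H, of x] edge_endpoints_less[OF G j] x
    unfolding eq by (auto simp: a_def edge_def)
qed

text \<open>
  Measured by normal derivatives, which point into the edge at both endpoints, the passage from one
  endpoint to the other is an involution.  So one formula describes an edge traversed in either
  direction.
\<close>

lemma helmholtz_transfer:
  assumes G: "metric_graph G" and "k > 0" and f: "helmholtz G k f" and j: "j \<in> {1..num_edges G}"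
    and ends: "ends_of_edge j i i'"
  defines "c \<equiv> complex_of_real (cos (k * edge_length G j))"
    and "s \<equiv> complex_of_real (sin (k * edge_length G j))"
  shows "endpoint_value G f i' = c * endpoint_value G f i + s * (normal_derivative G f i / of_real k)"
    and "normal_derivative G f i' / of_real k
      = s * endpoint_value G f i - c * (normal_derivative G f i / of_real k)"
proof -
  define v v' where "v = endpoint_value G f (2 * j - 1)" and "v' = endpoint_value G f (2 * j)"
  define w w' where "w = normal_derivative G f (2 * j - 1) / of_real k"
    and "w' = normal_derivative G f (2 * j) / of_real k"
  have right: "endpoint G (2 * j) \<in> edge G j"
    using edge_endpoints_less[OF G j] by (auto simp: edge_def)
  have v': "v' = c * v + s * w"
    using helmholtz_on_edge(1)[OF G \<open>k > 0\<close> f j right] j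
    by (simp add: v'_def v_def w_def c_def s_def endpoint_value_def[of G f "2 * j"] endpoint_edge_simps edge_length_def)
  have w': "w' = s * v - c * w"
    using helmholtz_on_edge(2)[OF G \<open>k > 0\<close> f j right] j
    by (simp add: w'_def v_def w_def c_def s_def normal_derivative_def[of G f "2 * j"] endpoint_edge_simps edge_length_def)
  have cs: "c * c + s * s = 1"
    by (metis c_def s_def of_real_1 of_real_add of_real_mult sin_cos_squared_add3)
  have "c * v' + s * w' = (c * c + s * s) * v" "s * v' - c * w' = (c * c + s * s) * w"
    by (simp_all add: v' w' algebra_simps)
  then have v: "v = c * v' + s * w'" and w: "w = s * v' - c * w'" by (simp_all add: cs)
  consider "i = 2 * j - 1" "i' = 2 * j" | "i = 2 * j" "i' = 2 * j - 1"
    using ends by (auto simp: ends_of_edge_def)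
  then have "endpoint_value G f i' = c * endpoint_value G f i + s * (normal_derivative G f i / of_real k)
      \<and> normal_derivative G f i' / of_real k
        = s * endpoint_value G f i - c * (normal_derivative G f i / of_real k)"
  proof cases
    case 1
    show ?thesis unfolding 1 using v' w' by (simp add: v_def v'_def w_def w'_def)
  next
    case 2
    show ?thesis unfolding 2 using v w unfolding v_def v'_def w_def w'_def by blast
  qed
  then show "endpoint_value G f i' = c * endpoint_value G f i + s * (normal_derivative G f i / of_real k)"
    "normal_derivative G f i' / of_real k
      = s * endpoint_value G f i - c * (normal_derivative G f i / of_real k)" by blast+
qed

lemma helmholtz_eq_zero_on_edge:
  assumes G: "metric_graph G" and "k > 0" and f: "helmholtz G k f" and j: "j \<in> {1..num_edges G}"
    and ends: "ends_of_edge j i i'" and "endpoint_value G f i = 0" "normal_derivative G f i = 0"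
  shows "f j x = 0"
proof (cases "x \<in> edge G j")
  case True
  have "ends_of_edge j i (2 * j - 1) \<or> i = 2 * j - 1"
    using ends by (auto simp: ends_of_edge_def)
  then have "endpoint_value G f (2 * j - 1) = 0 \<and> normal_derivative G f (2 * j - 1) / of_real k = 0"
    using helmholtz_transfer[OF G \<open>k > 0\<close> f j, of i "2 * j - 1"] assms by auto
  then show ?thesis using helmholtz_on_edge(1)[OF G \<open>k > 0\<close> f j True] by simp
next
  case False
  then show ?thesis using f by (simp add: helmholtz_def)
qed

lemma helmholtz_exists:
  fixes v w :: "nat \<Rightarrow> complex"
  assumes G: "metric_graph G" and "k > 0" and ends: "\<And>j. j \<in> {1..num_edges G} \<Longrightarrow> ends_of_edge j (i j) (i' j)"
  obtains f where "helmholtz G k f"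
    "\<And>j. j \<in> {1..num_edges G} \<Longrightarrow> endpoint_value G f (i j) = v j"
    "\<And>j. j \<in> {1..num_edges G} \<Longrightarrow> normal_derivative G f (i j) / of_real k = w j"
proof -
  define c s where "c = (\<lambda>j. complex_of_real (cos (k * edge_length G j)))"
    and "s = (\<lambda>j. complex_of_real (sin (k * edge_length G j)))"
  define v0 w0 where "v0 = (\<lambda>j. if i j = 2 * j - 1 then v j else c j * v j + s j * w j)"
    and "w0 = (\<lambda>j. if i j = 2 * j - 1 then w j else s j * v j - c j * w j)"
  define a where "a = (\<lambda>j. endpoint G (2 * j - 1))"
  define f where "f = (\<lambda>j x. if j \<in> {1..num_edges G} \<and> x \<in> edge G j
    then of_real (cos (k * (x - a j))) * v0 j + of_real (sin (k * (x - a j))) * w0 j else 0)"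
  have less: "a j < endpoint G (2 * j)" if "j \<in> {1..num_edges G}" for j
    using edge_endpoints_less[OF G that] by (simp add: a_def)
  have fj: "f j x = of_real (cos (k * (x - a j))) * v0 j + of_real (sin (k * (x - a j))) * w0 j"
    if "j \<in> {1..num_edges G}" "x \<in> {a j..endpoint G (2 * j)}" for j x
    using that by (simp add: f_def edge_def a_def)
  have f: "helmholtz G k f"
    unfolding helmholtz_def
    using helmholtz_on_interval_exists(1)[OF less \<open>k > 0\<close> fj] by (auto simp: f_def a_def)
  have left: "endpoint_value G f (2 * j - 1) = v0 j" "normal_derivative G f (2 * j - 1) / of_real k = w0 j"
    if j: "j \<in> {1..num_edges G}" for j
  proof -
    have "f j (a j) = v0 j" using fj[OF j, of "a j"] less[OF j] by simp
    then show "endpoint_value G f (2 * j - 1) = v0 j"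
      using j by (simp add: endpoint_value_def endpoint_edge_simps a_def)
    show "normal_derivative G f (2 * j - 1) / of_real k = w0 j"
      using helmholtz_on_interval_exists(2)[OF less[OF j] \<open>k > 0\<close> fj[OF j]] j \<open>k > 0\<close>
      by (simp add: normal_derivative_def endpoint_edge_simps a_def edge_def)
  qed
  have "endpoint_value G f (i j) = v j \<and> normal_derivative G f (i j) / of_real k = w j"
    if j: "j \<in> {1..num_edges G}" for j
  proof (cases "i j = 2 * j - 1")
    case True
    then show ?thesis using left[OF j] by (simp add: v0_def w0_def)
  next
    case False
    then have ends': "ends_of_edge j (2 * j - 1) (i j)"
      using ends[OF j] by (auto simp: ends_of_edge_def)
    have cs: "c j * c j + s j * s j = 1"
      unfolding c_def s_def by (metis of_real_1 of_real_add of_real_mult sin_cos_squared_add3)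
    have "endpoint_value G f (i j) = c j * v0 j + s j * w0 j"
      "normal_derivative G f (i j) / of_real k = s j * v0 j - c j * w0 j"
      using helmholtz_transfer[OF G \<open>k > 0\<close> f j ends'] unfolding left[OF j] c_def s_def by blast+
    moreover have "c j * v0 j + s j * w0 j = (c j * c j + s j * s j) * v j"
      "s j * v0 j - c j * w0 j = (c j * c j + s j * s j) * w j"
      using False by (simp_all add: v0_def w0_def algebra_simps)
    ultimately show ?thesis by (simp add: cs)
  qed
  with f that show thesis by blast
qed

text \<open>
  Finiteness of the dimension makes the multiplicity a faithful count: \<open>dim\<close> is 0 by convention on
  spaces of infinite dimension, so a nonzero eigenspace has positive multiplicity only because of
  this bound.
\<close>

lemma helmholtz_finite_span:
  assumes G: "metric_graph G" and "k > 0"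
  obtains S where "finite S" "Collect (helmholtz G k) \<subseteq> gfun.span S"
proof -
  define C where "C = (\<lambda>j j' x. if j' = j \<and> x \<in> edge G j
    then complex_of_real (cos (k * (x - endpoint G (2 * j - 1)))) else 0)"
  define D where "D = (\<lambda>j j' x. if j' = j \<and> x \<in> edge G j
    then complex_of_real (sin (k * (x - endpoint G (2 * j - 1)))) else 0)"
  define I where "I = {1..num_edges G}"
  have "f \<in> gfun.span (C ` I \<union> D ` I)" if f: "helmholtz G k f" for f
  proof -
    define v w where "v = (\<lambda>j. endpoint_value G f (2 * j - 1))"
      and "w = (\<lambda>j. normal_derivative G f (2 * j - 1) / of_real k)"
    have sum_apply: "(\<Sum>j\<in>I. gscale (u j) (B j)) i x = (\<Sum>j\<in>I. u j * B j i x)" for u B i x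
      by (induction I rule: infinite_finite_induct) (auto simp: gscale_def)
    have "f = (\<Sum>j\<in>I. gscale (v j) (C j)) + (\<Sum>j\<in>I. gscale (w j) (D j))"
    proof (intro ext)
      fix i x
      show "f i x = ((\<Sum>j\<in>I. gscale (v j) (C j)) + (\<Sum>j\<in>I. gscale (w j) (D j))) i x"
      proof (cases "i \<in> I \<and> x \<in> edge G i")
        case True
        have "(\<Sum>j\<in>I. v j * C j i x) = (\<Sum>j\<in>I. if j = i then v i * C i i x else 0)"
          "(\<Sum>j\<in>I. w j * D j i x) = (\<Sum>j\<in>I. if j = i then w i * D i i x else 0)"
          by (auto intro!: sum.cong simp: C_def D_def)
        then have "(\<Sum>j\<in>I. v j * C j i x) = v i * C i i x" "(\<Sum>j\<in>I. w j * D j i x) = w i * D i i x"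
          using True by (simp_all add: I_def)
        moreover have "f i x = v i * C i i x + w i * D i i x"
          using True helmholtz_on_edge(1)[OF G \<open>k > 0\<close> f, of i x]
          by (simp add: I_def C_def D_def v_def w_def mult.commute)
        ultimately show ?thesis by (simp only: plus_fun_def sum_apply)
      next
        case False
        then have "f i x = 0" using f by (auto simp: helmholtz_def I_def)
        moreover have "C j i x = 0" "D j i x = 0" if "j \<in> I" for j
          using False that by (auto simp: C_def D_def)
        ultimately show ?thesis by (simp add: sum_apply)
      qed
    qed
    also have "\<dots> \<in> gfun.span (C ` I \<union> D ` I)"
      by (intro gfun.span_add gfun.span_sum gfun.span_scale gfun.span_base) auto
    finally show ?thesis .
  qed
  then show thesis using that[of "C ` I \<union> D ` I"] by (auto simp: I_def)
qed

lemma eigenspace_helmholtz: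
  "f \<in> eigenspace G \<alpha> (of_real (k\<^sup>2)) \<longleftrightarrow> helmholtz G k f \<and> f \<in> laplacian_domain G \<alpha>"
  by (auto simp: eigenspace_def laplacian_def helmholtz_def laplacian_domain_def matching_domain_def
      W22_graph_def gscale_def)

lemma vertex_endpoint_in_edge:
  assumes G: "metric_graph G" and m: "m \<in> {1..num_vertices G}" and i: "i \<in> vertex G m"
  shows "endpoint_edge i \<in> {1..num_edges G}" "endpoint G i \<in> edge G (endpoint_edge i)"
proof -
  have "i \<in> {1..2 * num_edges G}"
    using assms by (auto simp: metric_graph_def dest!: partition_onD1)
  then show "endpoint_edge i \<in> {1..num_edges G}" by (auto simp: endpoint_edge_def)
  moreover have "i = 2 * endpoint_edge i - 1 \<or> i = 2 * endpoint_edge i"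
    by (auto simp: endpoint_edge_def)
  ultimately show "endpoint G i \<in> edge G (endpoint_edge i)"
    using edge_endpoints_less[OF G, of "endpoint_edge i"] unfolding edge_def by (metis atLeastAtMost_iff order_refl less_imp_le)
qed

lemma normal_derivative_zero:
  assumes G: "metric_graph G" and "m \<in> {1..num_vertices G}" "i \<in> vertex G m"
  shows "normal_derivative G 0 i = 0"
proof -
  have "vector_derivative (\<lambda>x. 0 :: complex) (at x within edge G j) = 0"
    if "j \<in> {1..num_edges G}" "x \<in> edge G j" for j x
    using vector_derivative_within_cbox[OF edge_endpoints_less[OF G that(1)], of x "\<lambda>x. 0 :: complex" 0] that(2)
    by (simp add: edge_def)
  moreover have "(0 :: gfun) j = (\<lambda>x. 0)" for j by (simp add: fun_eq_iff)
  ultimately show ?thesis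
    using vertex_endpoint_in_edge[OF assms] by (simp add: normal_derivative_def)
qed

lemma zero_in_eigenspace:
  assumes G: "metric_graph G" and "k > 0"
  shows "0 \<in> eigenspace G \<alpha> (of_real (k\<^sup>2))"
proof -
  have L2: "has_L2_second_derivative (\<lambda>x. 0) (\<lambda>x. 0) (endpoint G (2 * j - 1)) (endpoint G (2 * j))"
    if "j \<in> {1..num_edges G}" for j
    using helmholtz_on_interval_exists(1)[OF edge_endpoints_less[OF G that] \<open>k > 0\<close>, of "\<lambda>x. 0" 0 0] by simp
  have zero: "(0 :: gfun) j = (\<lambda>x. 0)" for j by (simp add: fun_eq_iff)
  have "\<exists>h. has_L2_second_derivative ((0 :: gfun) j) h (endpoint G (2 * j - 1)) (endpoint G (2 * j))"
    if "j \<in> {1..num_edges G}" for j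
    unfolding zero by (rule exI[of _ "\<lambda>x. 0"]) (rule L2[OF that])
  then have "0 \<in> W22_graph G" by (simp add: W22_graph_def)
  moreover have "endpoint_value G 0 i = 0" for i
    by (simp add: endpoint_value_def)
  ultimately have "0 \<in> laplacian_domain G \<alpha>"
    using normal_derivative_zero[OF G]
    by (auto simp: laplacian_domain_def matching_domain_def
        vertex_sum_def normal_derivative_sum_def split: vertex_type.split)
  moreover have "helmholtz G k 0"
    unfolding helmholtz_def zero using L2 by simp
  ultimately show ?thesis by (intro eigenspace_helmholtz[THEN iffD2] conjI)
qed

text \<open>
  A nonzero eigenfunction makes \<open>A - k\<^sup>2\<close> non-injective, so \<open>k\<^sup>2\<close> is in the spectrum and has
  positive multiplicity; by isospectrality its multiplicity for the other operator is positive too.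
\<close>

lemma isospectral_eigenfunction:
  assumes G: "metric_graph G" and "k > 0" and iso: "isospectral G \<alpha> \<beta>"
    and f: "f \<in> eigenspace G \<alpha> (of_real (k\<^sup>2))" "f \<noteq> 0"
  obtains g where "g \<in> eigenspace G \<beta> (of_real (k\<^sup>2))" "g \<noteq> 0"
proof -
  define \<mu> where "\<mu> = complex_of_real (k\<^sup>2)"
  have "\<mu> \<notin> resolvent_set G \<alpha>"
  proof
    assume "\<mu> \<in> resolvent_set G \<alpha>"
    then have "\<forall>g\<in>L2_graph G. \<exists>!f. (f, g + gscale \<mu> f) \<in> laplacian G \<alpha>"
      by (simp add: resolvent_set_def)
    moreover have "0 \<in> L2_graph G"
      by (auto simp: L2_graph_def square_integrable_on_def set_borel_measurable_def
        set_integrable_def)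
    ultimately have "\<exists>!f. (f, 0 + gscale \<mu> f) \<in> laplacian G \<alpha>"
      by (rule bspec)
    moreover have "(f, 0 + gscale \<mu> f) \<in> laplacian G \<alpha>" "(0, 0 + gscale \<mu> 0) \<in> laplacian G \<alpha>"
      using f(1) zero_in_eigenspace[OF G \<open>k > 0\<close>, of \<alpha>] by (simp_all add: eigenspace_def \<mu>_def)
    ultimately have "f = 0" by (metis (no_types, lifting))
    then show False using f(2) by simp
  qed
  then have dim_eq: "gfun_dim (eigenspace G \<alpha> \<mu>) = gfun_dim (eigenspace G \<beta> \<mu>)"
    using iso by (auto simp: isospectral_def laplacian_spectrum_def multiplicity_in_spectrum_def)
  obtain S where S: "finite S" "Collect (helmholtz G k) \<subseteq> gfun.span S"
    using helmholtz_finite_span[OF G \<open>k > 0\<close>] by blast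
  obtain B where B: "B \<subseteq> eigenspace G \<alpha> \<mu>" "\<not> gfun.dependent B" "eigenspace G \<alpha> \<mu> \<subseteq> gfun.span B"
      "card B = gfun_dim (eigenspace G \<alpha> \<mu>)"
    by (rule gfun.basis_exists)
  have "B \<subseteq> gfun.span S"
  proof
    fix b assume "b \<in> B"
    then have "b \<in> eigenspace G \<alpha> (of_real (k\<^sup>2))" using B(1) by (auto simp only: \<mu>_def)
    then have "helmholtz G k b" by (rule eigenspace_helmholtz[THEN iffD1, THEN conjunct1])
    then show "b \<in> gfun.span S" using S(2) by auto
  qed
  then have "finite B"
    using gfun.independent_span_bound[OF S(1) B(2)] by blast
  moreover have "B \<noteq> {}"
  proof
    assume "B = {}"
    then show False using B(3) f gfun.span_empty by (auto simp only: \<mu>_def)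
  qed
  ultimately have "gfun_dim (eigenspace G \<beta> \<mu>) > 0" using B(4) dim_eq card_gt_0_iff[of B] by simp
  moreover obtain B' where B': "B' \<subseteq> eigenspace G \<beta> \<mu>" "\<not> gfun.dependent B'"
      "eigenspace G \<beta> \<mu> \<subseteq> gfun.span B'" "card B' = gfun_dim (eigenspace G \<beta> \<mu>)"
    by (rule gfun.basis_exists)
  ultimately have "card B' > 0" by simp
  then obtain g where "g \<in> B'" by (metis card.empty ex_in_conv less_irrefl)
  moreover from this have "g \<noteq> 0" using B'(2) gfun.dependent_zero by blast
  ultimately show thesis using B'(1) that[of g] by (auto simp only: \<mu>_def)
qed

section \<open>The secular equation\<close>

text \<open>
  Let \<open>x\<^sub>j = k l\<^sub>j\<close> be the phases of the four edges.  The solution on edge 1 that satisfies the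
  condition at \<open>V\<^sub>1\<close> has value \<open>A\<close> and normal derivative \<open>k (sin x\<^sub>1 - a\<^sub>1 cos x\<^sub>1)\<close> at \<open>V\<^sub>2\<close>; the
  solution on edge 4 that satisfies the condition at \<open>V\<^sub>4\<close> has value \<open>P\<close> and normal derivative
  \<open>- k Q\<close> at \<open>V\<^sub>3\<close>.  After elimination of the two parallel edges there remain two linear equations
  for the amplitudes on edges 1 and 4.  The secular form is their determinant, normalised so that
  it is a trigonometric polynomial.
\<close>

definition secular_form ::
    "real \<Rightarrow> real \<Rightarrow> real \<Rightarrow> real \<Rightarrow> real \<Rightarrow> real \<Rightarrow> real \<Rightarrow> real \<Rightarrow> real \<Rightarrow> real \<Rightarrow> real" where
  "secular_form a1 a2 p3 q3 p4 q4 x1 x2 x3 x4 =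
    (let A = cos x1 + a1 * sin x1; B = sin x1 - a1 * cos x1 - a2 * A;
         P = q4 * sin x4 - p4 * cos x4; Q = q4 * cos x4 + p4 * sin x4; V = q3 * P - p3 * Q
     in B * V * (cos x2 * cos x3) + (q3 * B * Q + A * V) * sin (x2 + x3)
        - 2 * q3 * A * Q * (1 + cos (x2 + x3)))"

text \<open>
  In units of \<open>k = 1 / \<epsilon>\<close>, the condition \<open>value = - \<alpha> \<cdot> derivative\<close> at a \<open>\<delta>'\<close> vertex reads
  \<open>q \<cdot> value = - p \<cdot> derivative\<close>.  With \<open>q = \<epsilon> / \<alpha>\<close> for \<open>\<alpha> \<noteq> 0\<close> it has a limit as \<open>\<epsilon> \<rightarrow> 0\<close>, namely
  a Neumann condition, with correction proportional to \<open>1 / \<alpha>\<close>.  For \<open>\<alpha> = 0\<close> it is a Dirichlet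
  condition at all energies.
\<close>

definition coupling_p :: "real \<Rightarrow> real" where
  "coupling_p \<alpha> = (if \<alpha> = 0 then 0 else 1)"

definition coupling_q :: "real \<Rightarrow> real \<Rightarrow> real" where
  "coupling_q \<epsilon> \<alpha> = (if \<alpha> = 0 then 1 else \<epsilon> / \<alpha>)"

definition secular :: "(nat \<Rightarrow> real) \<Rightarrow> real \<Rightarrow> real ^ 4 \<Rightarrow> real" where
  "secular \<alpha> \<epsilon> x = secular_form (\<epsilon> * \<alpha> 1) (\<epsilon> * \<alpha> 2) (coupling_p (\<alpha> 3)) (coupling_q \<epsilon> (\<alpha> 3))
     (coupling_p (\<alpha> 4)) (coupling_q \<epsilon> (\<alpha> 4)) (x $ 1) (x $ 2) (x $ 3) (x $ 4)"

text \<open>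
  The left-hand side is the determinant of the two amplitude equations, each multiplied by \<open>C\<close> to
  clear denominators.  The identity \<open>S\<^sup>2 - E\<^sup>2 = - 2 C (1 + cos (x\<^sub>2 + x\<^sub>3))\<close> makes one factor \<open>C\<close> split off
  again.
\<close>

lemma secular_form_det:
  fixes a1 a2 p3 q3 p4 q4 x1 x2 x3 x4 :: real
  defines "A \<equiv> cos x1 + a1 * sin x1"
  defines "B \<equiv> sin x1 - a1 * cos x1 - a2 * A"
  defines "P \<equiv> q4 * sin x4 - p4 * cos x4" and "Q \<equiv> q4 * cos x4 + p4 * sin x4"
  defines "V \<equiv> q3 * P - p3 * Q"
    and "S \<equiv> sin (x2 + x3)" and "C \<equiv> cos x2 * cos x3" and "E \<equiv> cos x2 + cos x3"
  shows "(B * C + A * S) * (V * C + q3 * Q * S) - (Q * E) * (q3 * A * E)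
    = C * secular_form a1 a2 p3 q3 p4 q4 x1 x2 x3 x4"
proof -
  have "S\<^sup>2 = (sin x2)\<^sup>2 * (cos x3)\<^sup>2 + (cos x2)\<^sup>2 * (sin x3)\<^sup>2 + 2 * sin x2 * sin x3 * C"
    unfolding S_def C_def sin_add by (simp add: power2_eq_square algebra_simps)
  then have "S\<^sup>2 - E\<^sup>2 = (1 - (cos x2)\<^sup>2) * (cos x3)\<^sup>2 + (cos x2)\<^sup>2 * (1 - (cos x3)\<^sup>2)
      + 2 * sin x2 * sin x3 * C - E\<^sup>2"
    by (simp only: sin_squared_eq)
  also have "\<dots> = - 2 * C * (1 + cos (x2 + x3))"
    by (simp add: cos_add C_def E_def power2_eq_square algebra_simps)
  finally have *: "S\<^sup>2 - E\<^sup>2 = - 2 * C * (1 + cos (x2 + x3))" .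
  have "(B * C + A * S) * (V * C + q3 * Q * S) - (Q * E) * (q3 * A * E)
      = B * V * C\<^sup>2 + C * S * (q3 * B * Q + A * V) + q3 * A * Q * (S\<^sup>2 - E\<^sup>2)"
    by (simp add: power2_eq_square algebra_simps)
  also have "\<dots> = C * (B * V * C + (q3 * B * Q + A * V) * S - 2 * q3 * A * Q * (1 + cos (x2 + x3)))"
    unfolding * by (simp add: power2_eq_square algebra_simps)
  also have "\<dots> = C * secular_form a1 a2 p3 q3 p4 q4 x1 x2 x3 x4"
    unfolding secular_form_def Let_def A_def B_def P_def Q_def V_def S_def C_def by simp
  finally show ?thesis .
qed

lemma real_kernel_2x2:
  fixes a b c d :: real
  assumes "a * d = b * c"
  obtains x y where "x \<noteq> 0 \<or> y \<noteq> 0" "a * x + b * y = 0" "c * x + d * y = 0"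
proof (cases "a = 0 \<and> b = 0")
  case True
  then show thesis
    by (cases "c = 0 \<and> d = 0") (use that[of 1 0] that[of d "- c"] in auto)
next
  case False
  then show thesis using that[of b "- a"] assms by (auto simp: algebra_simps)
qed

lemma kernel_2x2_det:
  fixes a b c d x y :: "'a::field"
  assumes "x \<noteq> 0 \<or> y \<noteq> 0" "a * x + b * y = 0" "c * x + d * y = 0"
  shows "a * d - b * c = 0"
proof -
  have "(a * d - b * c) * x = d * (a * x + b * y) - b * (c * x + d * y)"
    "(a * d - b * c) * y = a * (c * x + d * y) - c * (a * x + b * y)"
    by (simp_all add: algebra_simps)
  with assms show ?thesis by auto
qed

text \<open>
  On the two parallel edges a solution is fixed by the common value \<open>\<phi>\<close> at \<open>V\<^sub>2\<close> and the common
  normal derivative \<open>d\<close> at \<open>V\<^sub>3\<close>, provided that the cosines do not vanish.  The two remaining sums,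
  of the derivatives at \<open>V\<^sub>2\<close> and of the values at \<open>V\<^sub>3\<close>, are expressed by \<open>\<phi>\<close> and \<open>d\<close>.
\<close>

lemma double_edge_conditions:
  fixes c2 s2 c3 s3 :: "'a::field"
  assumes "c2 \<noteq> 0" "c3 \<noteq> 0" "c2 * c2 + s2 * s2 = 1" "c3 * c3 + s3 * s3 = 1"
    and v: "v2 = c2 * \<phi> + s2 * w2" "v3 = c3 * \<phi> + s3 * w3"
    and d: "d = s2 * \<phi> - c2 * w2" "d = s3 * \<phi> - c3 * w3"
  shows "w1 + w2 + w3 = b \<longleftrightarrow> c2 * c3 * (w1 - b) + (s2 * c3 + c2 * s3) * \<phi> - (c2 + c3) * d = 0"
    and "c2 * c3 * (v2 + v3) = (c2 + c3) * \<phi> - (s2 * c3 + c2 * s3) * d"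
proof -
  have cw: "c2 * w2 = s2 * \<phi> - d" "c3 * w3 = s3 * \<phi> - d" using d(1) d(2)[symmetric] by (auto simp: algebra_simps)
  have "c2 * c3 * (w1 + w2 + w3 - b) = c2 * c3 * (w1 - b) + c3 * (c2 * w2) + c2 * (c3 * w3)"
    by (simp add: algebra_simps)
  also have "\<dots> = c2 * c3 * (w1 - b) + (s2 * c3 + c2 * s3) * \<phi> - (c2 + c3) * d"
    unfolding cw by (simp add: algebra_simps)
  finally show "w1 + w2 + w3 = b \<longleftrightarrow> c2 * c3 * (w1 - b) + (s2 * c3 + c2 * s3) * \<phi> - (c2 + c3) * d = 0"
    using assms(1,2) by (metis eq_iff_diff_eq_0 mult_eq_0_iff)
  have "c2 * v2 = (c2 * c2) * \<phi> + s2 * (c2 * w2)" "c3 * v3 = (c3 * c3) * \<phi> + s3 * (c3 * w3)"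
    unfolding v by (simp_all add: algebra_simps)
  then have "c2 * v2 = (c2 * c2 + s2 * s2) * \<phi> - s2 * d" "c3 * v3 = (c3 * c3 + s3 * s3) * \<phi> - s3 * d"
    unfolding cw by (simp_all add: algebra_simps)
  then have cv: "c2 * v2 = \<phi> - s2 * d" "c3 * v3 = \<phi> - s3 * d"
    using assms(3,4) by simp_all
  have "c2 * c3 * (v2 + v3) = c3 * (c2 * v2) + c2 * (c3 * v3)" by (simp add: algebra_simps)
  also have "\<dots> = (c2 + c3) * \<phi> - (s2 * c3 + c2 * s3) * d"
    unfolding cv by (simp add: algebra_simps)
  finally show "c2 * c3 * (v2 + v3) = (c2 + c3) * \<phi> - (s2 * c3 + c2 * s3) * d" .
qed

lemma delta_prime_condition:
  fixes v w :: complex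
  assumes "k > 0"
  shows "v = - of_real (\<alpha> * k) * w \<longleftrightarrow>
      of_real (coupling_q (1 / k) \<alpha>) * v = - of_real (coupling_p \<alpha>) * w"
    and "v = - of_real (\<alpha> * k) * w \<longleftrightarrow>
      (\<exists>t. v = - of_real (coupling_p \<alpha>) * t \<and> w = of_real (coupling_q (1 / k) \<alpha>) * t)"
  using assms by (auto simp: coupling_p_def coupling_q_def field_simps intro: exI[of _ "- v"] exI[of _ w])

text \<open>
  The graph with both orientations of each edge treated alike: \<open>e j\<close> is the endpoint of edge \<open>j\<close>
  that is nearer to \<open>V\<^sub>1\<close>, and \<open>e' j\<close> the one nearer to \<open>V\<^sub>4\<close>.
\<close>

definition double_edge_path :: "marked_graph \<Rightarrow> (nat \<Rightarrow> nat) \<Rightarrow> (nat \<Rightarrow> nat) \<Rightarrow> bool" where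
  "double_edge_path G e e' \<longleftrightarrow>
     metric_graph G \<and> num_edges G = 4 \<and> num_vertices G = 4 \<and>
     (\<forall>j\<in>{1..4}. ends_of_edge j (e j) (e' j)) \<and>
     vertex G 1 = {e 1} \<and> vertex G 2 = {e' 1, e 2, e 3} \<and>
     vertex G 3 = {e' 2, e' 3, e 4} \<and> vertex G 4 = {e' 4} \<and>
     vertex_type G 1 = Delta \<and> vertex_type G 2 = Delta \<and>
     vertex_type G 3 = DeltaPrime \<and> vertex_type G 4 = DeltaPrime"

lemma laplacian_domain_iff:
  fixes f :: gfun and k :: real
  assumes path: "double_edge_path G e e'" and f: "helmholtz G k f" and "k > 0"
    and v: "v = endpoint_value G f" and w: "w = (\<lambda>i. normal_derivative G f i / of_real k)"
  shows "f \<in> laplacian_domain G \<alpha> \<longleftrightarrow>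
      w (e 1) = of_real (\<alpha> 1 / k) * v (e 1) \<and>
      v (e 2) = v (e' 1) \<and> v (e 3) = v (e' 1) \<and>
      w (e' 1) + w (e 2) + w (e 3) = of_real (\<alpha> 2 / k) * v (e' 1) \<and>
      w (e' 2) = w (e 4) \<and> w (e' 3) = w (e 4) \<and>
      v (e' 2) + v (e' 3) + v (e 4) = - of_real (\<alpha> 3 * k) * w (e 4) \<and>
      v (e' 4) = - of_real (\<alpha> 4 * k) * w (e' 4)"
proof -
  have graph: "metric_graph G" and edges: "num_edges G = 4" and vertices: "num_vertices G = 4"
    and ends: "\<And>j. j \<in> {1..4} \<Longrightarrow> ends_of_edge j (e j) (e' j)"
    and vertex1: "vertex G 1 = {e 1}" and vertex2: "vertex G 2 = {e' 1, e 2, e 3}"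
    and vertex3: "vertex G 3 = {e' 2, e' 3, e 4}" and vertex4: "vertex G 4 = {e' 4}"
    and types: "vertex_type G 1 = Delta" "vertex_type G 2 = Delta"
      "vertex_type G 3 = DeltaPrime" "vertex_type G 4 = DeltaPrime"
    using path unfolding double_edge_path_def by blast+
  define n where "n = normal_derivative G f"
  have n: "n i = of_real k * w i" for i using \<open>k > 0\<close> by (simp add: n_def w)
  have four: "{1..4::nat} = {1, 2, 3, 4}" by auto
  have dist: "e' 1 \<noteq> e 2" "e' 1 \<noteq> e 3" "e 2 \<noteq> e 3" "e' 2 \<noteq> e' 3" "e' 2 \<noteq> e 4" "e' 3 \<noteq> e 4"
    using ends[of 1] ends[of 2] ends[of 3] ends[of 4] by (auto simp: ends_of_edge_def)
  have W22: "f \<in> W22_graph G"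
    using f by (auto simp: W22_graph_def helmholtz_def)
  have val: "valence G 1 = 1" "valence G 2 = 3" "valence G 3 = 3" "valence G 4 = 1"
    using dist by (simp_all add: valence_def vertex1 vertex2 vertex3 vertex4 del: One_nat_def)
  have match: "f \<in> matching_domain G \<longleftrightarrow>
      v (e 2) = v (e' 1) \<and> v (e 3) = v (e' 1) \<and> n (e' 2) = n (e 4) \<and> n (e' 3) = n (e 4)"
    unfolding matching_domain_def vertices four
    by (auto simp: W22 internal_def val types vertex1 vertex2 vertex3 vertex4 v n_def simp del: One_nat_def)
  have sums: "vertex_sum G f 1 = v (e 1)" "vertex_sum G f 2 = v (e' 1) + v (e 2) + v (e 3)"
    "vertex_sum G f 3 = v (e' 2) + v (e' 3) + v (e 4)" "vertex_sum G f 4 = v (e' 4)"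
    "normal_derivative_sum G f 1 = n (e 1)"
    "normal_derivative_sum G f 2 = n (e' 1) + n (e 2) + n (e 3)"
    "normal_derivative_sum G f 3 = n (e' 2) + n (e' 3) + n (e 4)"
    "normal_derivative_sum G f 4 = n (e' 4)"
    using dist by (simp_all add: vertex_sum_def normal_derivative_sum_def vertex1 vertex2 vertex3 vertex4
        v n_def add.assoc del: One_nat_def)
  have "f \<in> laplacian_domain G \<alpha> \<longleftrightarrow> f \<in> matching_domain G \<and>
      n (e 1) = of_real (\<alpha> 1) * v (e 1) \<and>
      n (e' 1) + n (e 2) + n (e 3) = of_real (\<alpha> 2 / 3) * (v (e' 1) + v (e 2) + v (e 3)) \<and>
      v (e' 2) + v (e' 3) + v (e 4) = - of_real (\<alpha> 3 / 3) * (n (e' 2) + n (e' 3) + n (e 4)) \<and>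
      v (e' 4) = - of_real (\<alpha> 4) * n (e' 4)"
    unfolding laplacian_domain_def vertices four
    by (simp add: types sums val del: One_nat_def)
  moreover have "n (e 1) = of_real (\<alpha> 1) * v (e 1) \<longleftrightarrow> w (e 1) = of_real (\<alpha> 1 / k) * v (e 1)"
    unfolding n using \<open>k > 0\<close> by (simp add: field_simps)
  moreover have "n (e' 1) + n (e 2) + n (e 3) = of_real (\<alpha> 2 / 3) * (v (e' 1) + v (e 2) + v (e 3)) \<longleftrightarrow>
      w (e' 1) + w (e 2) + w (e 3) = of_real (\<alpha> 2 / k) * v (e' 1)"
    if "v (e 2) = v (e' 1)" "v (e 3) = v (e' 1)"
  proof -
    have lhs: "n (e' 1) + n (e 2) + n (e 3) = of_real k * (w (e' 1) + w (e 2) + w (e 3))"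
      by (simp add: n algebra_simps)
    have rhs: "of_real (\<alpha> 2 / 3) * (v (e' 1) + v (e 2) + v (e 3)) = of_real k * (of_real (\<alpha> 2 / k) * v (e' 1))"
      using \<open>k > 0\<close> by (simp add: that)
    show ?thesis unfolding lhs rhs using \<open>k > 0\<close> by (simp only: mult_cancel_left of_real_eq_0_iff) simp
  qed
  moreover have "v (e' 2) + v (e' 3) + v (e 4) = - of_real (\<alpha> 3 / 3) * (n (e' 2) + n (e' 3) + n (e 4)) \<longleftrightarrow>
      v (e' 2) + v (e' 3) + v (e 4) = - of_real (\<alpha> 3 * k) * w (e 4)"
    if "n (e' 2) = n (e 4)" "n (e' 3) = n (e 4)"
    unfolding that by (simp add: n mult.assoc)
  moreover have "v (e' 4) = - of_real (\<alpha> 4) * n (e' 4) \<longleftrightarrow> v (e' 4) = - of_real (\<alpha> 4 * k) * w (e' 4)"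
    by (simp add: n mult.assoc)
  moreover have "n (e' 2) = n (e 4) \<longleftrightarrow> w (e' 2) = w (e 4)" "n (e' 3) = n (e 4) \<longleftrightarrow> w (e' 3) = w (e 4)"
    using \<open>k > 0\<close> by (simp_all add: n)
  ultimately show ?thesis unfolding match by argo
qed

text \<open>
  The restriction on the cosines is what allows the parallel edges to be eliminated.  It is harmless
  because the secular equation is only solved near phases that satisfy it.
\<close>

lemma eigenvalue_iff_secular_zero:
  assumes path: "double_edge_path G e e'" and "k > 0"
    and cos23: "cos (k * edge_length G 2) \<noteq> 0" "cos (k * edge_length G 3) \<noteq> 0"
  shows "(\<exists>f\<in>eigenspace G \<alpha> (of_real (k\<^sup>2)). f \<noteq> 0) \<longleftrightarrow>
    secular_form (\<alpha> 1 / k) (\<alpha> 2 / k) (coupling_p (\<alpha> 3)) (coupling_q (1 / k) (\<alpha> 3))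
      (coupling_p (\<alpha> 4)) (coupling_q (1 / k) (\<alpha> 4)) (k * edge_length G 1) (k * edge_length G 2)
      (k * edge_length G 3) (k * edge_length G 4) = 0" (is "_ \<longleftrightarrow> ?D = 0")
proof -
  have graph: "metric_graph G" and edges: "num_edges G = 4" and vertices: "num_vertices G = 4"
    and ends: "\<And>j. j \<in> {1..4} \<Longrightarrow> ends_of_edge j (e j) (e' j)" and vertex4: "vertex G 4 = {e' 4}"
    using path unfolding double_edge_path_def by blast+
  define a1 a2 p3 q3 p4 q4 where "a1 = \<alpha> 1 / k" and "a2 = \<alpha> 2 / k"
    and "p3 = coupling_p (\<alpha> 3)" and "q3 = coupling_q (1 / k) (\<alpha> 3)"
    and "p4 = coupling_p (\<alpha> 4)" and "q4 = coupling_q (1 / k) (\<alpha> 4)"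
  define x where "x = (\<lambda>j. k * edge_length G j)"
  define A where "A = cos (x 1) + a1 * sin (x 1)"
  define B1 where "B1 = sin (x 1) - a1 * cos (x 1)"
  define B where "B = B1 - a2 * A"
  define P Q where "P = q4 * sin (x 4) - p4 * cos (x 4)" and "Q = q4 * cos (x 4) + p4 * sin (x 4)"
  define V where "V = q3 * P - p3 * Q"
  define S C E where "S = sin (x 2 + x 3)" and "C = cos (x 2) * cos (x 3)" and "E = cos (x 2) + cos (x 3)"
  have det: "(B * C + A * S) * (V * C + q3 * Q * S) - (Q * E) * (q3 * A * E) = C * ?D"
    using secular_form_det[where ?x1.0 = "x 1" and ?x2.0 = "x 2" and ?x3.0 = "x 3" and ?x4.0 = "x 4"
        and ?a1.0 = a1 and ?a2.0 = a2 and ?p3.0 = p3 and ?q3.0 = q3 and ?p4.0 = p4 and ?q4.0 = q4]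
    by (simp add: A_def B_def B1_def P_def Q_def V_def S_def C_def E_def x_def a1_def a2_def
        p3_def q3_def p4_def q4_def)
  have "C \<noteq> 0" using cos23 by (simp add: C_def x_def)
  define c s where "c = (\<lambda>j. complex_of_real (cos (x j)))" and "s = (\<lambda>j. complex_of_real (sin (x j)))"
  have cs: "c j * c j + s j * s j = 1" for j
    unfolding c_def s_def by (metis of_real_1 of_real_add of_real_mult sin_cos_squared_add3)
  have c23: "c 2 \<noteq> 0" "c 3 \<noteq> 0" using cos23 by (simp_all add: c_def x_def)
  \<comment> \<open>Once the two pendant edges satisfy the conditions at their outer vertices, with amplitudes
    \<open>r\<close> and \<open>t\<close>, the conditions at the two inner vertices become two linear equations.\<close>
  have reduce: "f \<in> laplacian_domain G \<alpha> \<longleftrightarrow>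
      v (e 2) = v (e' 1) \<and> v (e 3) = v (e' 1) \<and> w (e' 2) = w (e 4) \<and> w (e' 3) = w (e 4) \<and>
      of_real (B * C + A * S) * r + of_real (Q * E) * t = 0 \<and>
      of_real (q3 * A * E) * r + of_real (V * C + q3 * Q * S) * t = 0"
    if f: "helmholtz G k f" and v: "v = endpoint_value G f"
      and w: "w = (\<lambda>i. normal_derivative G f i / of_real k)"
      and r: "v (e 1) = r" "w (e 1) = of_real a1 * r"
      and t: "v (e' 4) = - of_real p4 * t" "w (e' 4) = of_real q4 * t" for f v w r t
  proof -
    have ends': "ends_of_edge j (e j) (e' j)" "ends_of_edge j (e' j) (e j)" "j \<in> {1..num_edges G}"
      if "j \<in> {1..4}" for j
      using ends[OF that] that edges by (auto simp: ends_of_edge_def)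
    have edge: "v (e' j) = c j * v (e j) + s j * w (e j)" "w (e' j) = s j * v (e j) - c j * w (e j)"
      "v (e j) = c j * v (e' j) + s j * w (e' j)" "w (e j) = s j * v (e' j) - c j * w (e' j)"
      if "j \<in> {1..4}" for j
      using helmholtz_transfer[OF graph \<open>k > 0\<close> f ends'(3)[OF that] ends'(1)[OF that]]
        helmholtz_transfer[OF graph \<open>k > 0\<close> f ends'(3)[OF that] ends'(2)[OF that]]
      unfolding v w c_def s_def x_def by blast+
    have v1: "v (e' 1) = of_real A * r" and w1: "w (e' 1) = of_real B1 * r"
      using edge(1,2)[of 1] r by (simp_all add: A_def B1_def c_def s_def algebra_simps)
    have v4: "v (e 4) = of_real P * t" and w4: "w (e 4) = - of_real Q * t"
      using edge(3,4)[of 4] t by (simp_all add: P_def Q_def c_def s_def algebra_simps)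
    have SCE: "of_real S = s 2 * c 3 + c 2 * s 3" "of_real C = c 2 * c 3" "of_real E = c 2 + c 3"
      by (simp_all add: S_def C_def E_def c_def s_def sin_add)
    have V2: "w (e' 1) + w (e 2) + w (e 3) = of_real a2 * v (e' 1) \<longleftrightarrow>
        of_real (B * C + A * S) * r + of_real (Q * E) * t = 0" (is "?lhs \<longleftrightarrow> ?rhs")
      and V3: "of_real q3 * (v (e' 2) + v (e' 3) + v (e 4)) = - of_real p3 * w (e 4) \<longleftrightarrow>
        of_real (q3 * A * E) * r + of_real (V * C + q3 * Q * S) * t = 0" (is "?lhs' \<longleftrightarrow> ?rhs'")
      if "v (e 2) = v (e' 1)" "v (e 3) = v (e' 1)" "w (e' 2) = w (e 4)" "w (e' 3) = w (e 4)"
    proof -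
      note middle = double_edge_conditions[OF c23 cs cs, of "v (e' 2)" "v (e' 1)" "w (e 2)" "v (e' 3)" "w (e 3)" "w (e 4)"]
      have prem: "v (e' 2) = c 2 * v (e' 1) + s 2 * w (e 2)" "v (e' 3) = c 3 * v (e' 1) + s 3 * w (e 3)"
        "w (e 4) = s 2 * v (e' 1) - c 2 * w (e 2)" "w (e 4) = s 3 * v (e' 1) - c 3 * w (e 3)"
        using edge(1,2)[of 2] edge(1,2)[of 3] that by simp_all
      have "?lhs \<longleftrightarrow> c 2 * c 3 * (w (e' 1) - of_real a2 * v (e' 1)) + (s 2 * c 3 + c 2 * s 3) * v (e' 1)
          - (c 2 + c 3) * w (e 4) = 0"
        by (rule middle(1)[OF prem])
      also have "\<dots> \<longleftrightarrow> ?rhs"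
        unfolding SCE[symmetric] v1 w1 w4 B_def by (simp add: algebra_simps)
      finally show "?lhs \<longleftrightarrow> ?rhs" .
      have "?lhs' \<longleftrightarrow> of_real C * (of_real q3 * (v (e' 2) + v (e' 3) + v (e 4)) + of_real p3 * w (e 4)) = 0"
        using \<open>C \<noteq> 0\<close> by (simp add: eq_neg_iff_add_eq_0)
      also have "of_real C * (of_real q3 * (v (e' 2) + v (e' 3) + v (e 4)) + of_real p3 * w (e 4))
          = of_real q3 * (c 2 * c 3 * (v (e' 2) + v (e' 3))) + of_real C * (of_real q3 * v (e 4) + of_real p3 * w (e 4))"
        unfolding SCE by (simp add: algebra_simps)
      also have "\<dots> = of_real (q3 * A * E) * r + of_real (V * C + q3 * Q * S) * t"
        unfolding middle(2)[OF prem] SCE(1,3)[symmetric] unfolding v1 v4 w4 V_def by (simp add: algebra_simps)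
      finally show "?lhs' \<longleftrightarrow> ?rhs'" .
    qed
    have V1: "w (e 1) = of_real (\<alpha> 1 / k) * v (e 1)" using r by (simp add: a1_def)
    have V4: "v (e' 4) = - of_real (\<alpha> 4 * k) * w (e' 4)"
      using t by (intro delta_prime_condition(2)[OF \<open>k > 0\<close>, THEN iffD2] exI[of _ t]) (simp add: p4_def q4_def)
    show ?thesis
      unfolding laplacian_domain_iff[OF path f \<open>k > 0\<close> v w]
      using V1 V2 V3 V4 delta_prime_condition(1)[OF \<open>k > 0\<close>, of "v (e' 2) + v (e' 3) + v (e 4)" "\<alpha> 3" "w (e 4)"]
      unfolding a2_def p3_def q3_def by argo
  qed
  show ?thesis
  proof
    assume "\<exists>f\<in>eigenspace G \<alpha> (of_real (k\<^sup>2)). f \<noteq> 0"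
    then obtain f where f: "helmholtz G k f" "f \<in> laplacian_domain G \<alpha>" "f \<noteq> 0"
      using eigenspace_helmholtz[of _ G \<alpha> k] by auto
    define v w where "v = endpoint_value G f" and "w = (\<lambda>i. normal_derivative G f i / of_real k)"
    note dom = laplacian_domain_iff[OF path f(1) \<open>k > 0\<close> v_def w_def, THEN iffD1, OF f(2)]
    define r where "r = v (e 1)"
    obtain t where t: "v (e' 4) = - of_real p4 * t" "w (e' 4) = of_real q4 * t"
      using delta_prime_condition(2)[OF \<open>k > 0\<close>, of "v (e' 4)" "\<alpha> 4" "w (e' 4)"] dom
      unfolding p4_def q4_def by auto
    have r: "v (e 1) = r" "w (e 1) = of_real a1 * r" using dom by (auto simp: r_def a1_def)
    note red = reduce[OF f(1) v_def w_def r t, THEN iffD1, OF f(2)]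
    have "r \<noteq> 0 \<or> t \<noteq> 0"
    proof (rule ccontr)
      assume "\<not> (r \<noteq> 0 \<or> t \<noteq> 0)"
      then have rt: "v (e 1) = 0" "w (e 1) = 0" "v (e' 4) = 0" "w (e' 4) = 0" using r t by auto
      have transfer: "v i' = c j * v i + s j * w i" "w i' = s j * v i - c j * w i"
        if "j \<in> {1..4}" "ends_of_edge j i i'" for i i' j
        using helmholtz_transfer[OF graph \<open>k > 0\<close> f(1) _ that(2)] that edges
        unfolding v_def w_def c_def s_def x_def by auto
      have ends4: "ends_of_edge 4 (e' 4) (e 4)" using ends[of 4] by (auto simp: ends_of_edge_def)
      have "v (e' 1) = 0" "w (e 4) = 0"
        using transfer(1)[OF _ ends, of 1] transfer(2)[OF _ ends4] rt by simp_all
      then have "v (e 2) = 0" "w (e' 2) = 0" "v (e 3) = 0" "w (e' 3) = 0" using red by auto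
      then have "w (e 2) = 0" "w (e 3) = 0"
        using transfer(2)[OF _ ends, of 2] transfer(2)[OF _ ends, of 3] c23 by auto
      have zero: "f j y = 0" if "j \<in> {1..4}" "ends_of_edge j i i'" "v i = 0" "w i = 0" for i i' j y
        using helmholtz_eq_zero_on_edge[OF graph \<open>k > 0\<close> f(1) _ that(2)] that \<open>k > 0\<close> edges
        by (auto simp: v_def w_def)
      have "f j y = 0" for j y
      proof (cases "j \<in> {1..4}")
        case True
        then consider "j = 1" | "j = 2" | "j = 3" | "j = 4" by fastforce
        then show ?thesis
          using zero[OF True] ends[OF True] ends4 rt \<open>v (e 2) = 0\<close> \<open>w (e 2) = 0\<close> \<open>v (e 3) = 0\<close> \<open>w (e 3) = 0\<close>
          by cases blast+
      next
        case False
        then show ?thesis using f(1) edges by (auto simp: helmholtz_def)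
      qed
      then show False using \<open>f \<noteq> 0\<close> by (auto simp: fun_eq_iff)
    qed
    then have "of_real (B * C + A * S) * of_real (V * C + q3 * Q * S)
        - of_real (Q * E) * of_real (q3 * A * E) = (0 :: complex)"
      by (rule kernel_2x2_det) (use red in blast)+
    then have "complex_of_real (C * ?D) = 0" by (simp only: of_real_mult[symmetric] of_real_diff[symmetric] det)
    then show "?D = 0" using \<open>C \<noteq> 0\<close> by simp
  next
    assume "?D = 0"
    then obtain r t where rt: "r \<noteq> 0 \<or> t \<noteq> 0" "(B * C + A * S) * r + Q * E * t = 0"
        "(q3 * A * E) * r + (V * C + q3 * Q * S) * t = 0"
      using real_kernel_2x2[of "B * C + A * S" "V * C + q3 * Q * S" "Q * E" "q3 * A * E"] det by auto
    define i i' where "i = (\<lambda>j. if j = 4 then e' j else e j)" and "i' = (\<lambda>j. if j = 4 then e j else e' j)"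
    have i: "ends_of_edge j (i j) (i' j)" if "j \<in> {1..num_edges G}" for j
      using ends[of j] that edges by (auto simp: i_def i'_def ends_of_edge_def)
    define \<phi> d where "\<phi> = complex_of_real (A * r)" and "d = complex_of_real (- Q * t)"
    obtain f where f: "helmholtz G k f"
      and fv: "\<And>j. j \<in> {1..num_edges G} \<Longrightarrow> endpoint_value G f (i j) =
        (if j = 1 then of_real r else if j = 4 then of_real (- p4 * t) else \<phi>)"
      and fw: "\<And>j. j \<in> {1..num_edges G} \<Longrightarrow> normal_derivative G f (i j) / of_real k =
        (if j = 1 then of_real (a1 * r) else if j = 4 then of_real (q4 * t) else (s j * \<phi> - d) / c j)"
      using helmholtz_exists[OF graph \<open>k > 0\<close> i, where v = "\<lambda>j. if j = 1 then of_real r else if j = 4 then of_real (- p4 * t) else \<phi>"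
        and w = "\<lambda>j. if j = 1 then of_real (a1 * r) else if j = 4 then of_real (q4 * t) else (s j * \<phi> - d) / c j"]
      by blast
    define v where "v = endpoint_value G f"
    define w where "w = (\<lambda>i. normal_derivative G f i / of_real k)"
    have data: "v (e 1) = of_real r" "w (e 1) = of_real a1 * of_real r"
      "v (e' 4) = - of_real p4 * of_real t" "w (e' 4) = of_real q4 * of_real t"
      "v (e 2) = \<phi>" "c 2 * w (e 2) = s 2 * \<phi> - d" "v (e 3) = \<phi>" "c 3 * w (e 3) = s 3 * \<phi> - d"
      using fv[of 1] fv[of 2] fv[of 3] fv[of 4] fw[of 1] fw[of 2] fw[of 3] fw[of 4] c23 edges
      unfolding v_def w_def i_def by simp_all
    have transfer: "v i' = c j * v i + s j * w i" "w i' = s j * v i - c j * w i"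
      if "j \<in> {1..4}" "ends_of_edge j i i'" for i i' j
      using helmholtz_transfer[OF graph \<open>k > 0\<close> f _ that(2)] that edges
      unfolding v_def w_def c_def s_def x_def by auto
    have ends4: "ends_of_edge 4 (e' 4) (e 4)" using ends[of 4] by (auto simp: ends_of_edge_def)
    have "v (e' 1) = \<phi>" using transfer(1)[OF _ ends, of 1] data
      by (simp add: \<phi>_def A_def c_def s_def algebra_simps)
    moreover have "w (e 4) = d" using transfer(2)[OF _ ends4] data
      by (simp add: d_def Q_def c_def s_def algebra_simps)
    moreover have "w (e' 2) = d" "w (e' 3) = d"
      using transfer(2)[OF _ ends, of 2] transfer(2)[OF _ ends, of 3] data by simp_all
    moreover have "of_real (B * C + A * S) * of_real r + of_real (Q * E) * of_real t = (0 :: complex)"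
      "of_real (q3 * A * E) * of_real r + of_real (V * C + q3 * Q * S) * of_real t = (0 :: complex)"
      using rt(2,3) by (simp_all only: flip: of_real_mult of_real_add) simp_all
    ultimately have "f \<in> laplacian_domain G \<alpha>"
      using reduce[OF f v_def w_def data(1-4)] data by simp
    moreover have "f \<noteq> 0"
    proof
      assume "f = 0"
      have "e' 4 \<in> vertex G 4" "(4::nat) \<in> {1..num_vertices G}" using vertex4 vertices by auto
      then have "v (e 1) = 0" "v (e' 4) = 0" "w (e' 4) = 0"
        using normal_derivative_zero[OF graph, of 4 "e' 4"]
        by (simp_all add: v_def w_def \<open>f = 0\<close> endpoint_value_def)
      then show False using data rt(1) by (auto simp: p4_def q4_def coupling_p_def coupling_q_def split: if_splits)
    qed
    ultimately show "\<exists>f\<in>eigenspace G \<alpha> (of_real (k\<^sup>2)). f \<noteq> 0"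
      using f eigenspace_helmholtz by blast
  qed
qed

section \<open>Zeros along a dense line on the torus\<close>

text \<open>
  Kronecker's theorem for the linear flow on a torus, with the passage at a time beyond any given
  bound.  The limit \<open>k \<rightarrow> \<infinity>\<close> of the spectrum can only be probed at late times.
\<close>

lemma kronecker_flow:
  fixes l y :: "'n::finite \<Rightarrow> real"
  assumes indep: "\<And>q :: 'n \<Rightarrow> int. (\<Sum>i\<in>UNIV. of_int (q i) * l i) = 0 \<Longrightarrow> \<forall>i. q i = 0"
    and "\<epsilon> > 0"
  obtains t h where "t > K" "\<And>i. \<bar>t * l i - 2 * pi * of_int (h i) - y i\<bar> < \<epsilon>"
proof -
  define n where "n = CARD('n)"
  obtain e where e: "bij_betw e {..<n} (UNIV :: 'n set)"
    using ex_bij_betw_nat_finite[of "UNIV :: 'n set"] by (auto simp: n_def atLeast0LessThan)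
  define \<theta> where "\<theta> = (\<lambda>r. l (e r) / (2 * pi))"
  define \<delta> where "\<delta> = \<epsilon> / (4 * pi)"
  have "\<delta> > 0" using \<open>\<epsilon> > 0\<close> by (simp add: \<delta>_def)
  have indep': "\<forall>r<n. q r = 0" if "(\<Sum>r<n. of_int (q r) * \<theta> r) = 0" for q :: "nat \<Rightarrow> int"
  proof -
    define q' where "q' = (\<lambda>i. q (inv_into {..<n} e i))"
    have "(\<Sum>i\<in>UNIV. of_int (q' i) * l i) = (\<Sum>r<n. of_int (q' (e r)) * l (e r))"
      using sum.reindex_bij_betw[OF e, of "\<lambda>i. of_int (q' i) * l i"] by simp
    also have "\<dots> = (\<Sum>r<n. 2 * pi * (of_int (q r) * \<theta> r))"
      using e by (intro sum.cong) (auto simp: q'_def \<theta>_def bij_betw_inv_into_left)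
    also have "\<dots> = 0" using that by (simp flip: sum_distrib_left)
    finally have q': "q' i = 0" for i using indep[of q'] by blast
    show ?thesis
    proof (intro allI impI)
      fix r assume "r < n"
      then show "q r = 0" using q'[of "e r"] e by (simp add: q'_def bij_betw_inv_into_left)
    qed
  qed
  have inj: "inj_on \<theta> {..<n}"
  proof (rule inj_onI, rule ccontr)
    fix r s assume rs: "r \<in> {..<n}" "s \<in> {..<n}" "\<theta> r = \<theta> s" "r \<noteq> s"
    have "(\<Sum>i<n. of_int (if i = r then 1 else if i = s then -1 else 0) * \<theta> i)
        = (\<Sum>i<n. (if i = r then \<theta> r else 0) - (if i = s then \<theta> s else 0))"
      using rs by (intro sum.cong) auto
    also have "\<dots> = 0" using rs by (simp add: sum_subtractf)
    finally show False using indep'[of "\<lambda>i. if i = r then 1 else if i = s then -1 else 0"] rs by auto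
  qed
  have module: "module (\<lambda>r. (*) (real_of_int r))"
    by (simp add: Modules.module.intro distrib_left mult.commute)
  have "\<not> module.dependent (\<lambda>r. (*) (real_of_int r)) (\<theta> ` {..<n})"
  proof
    assume "module.dependent (\<lambda>r. (*) (real_of_int r)) (\<theta> ` {..<n})"
    then obtain u where u: "(\<Sum>v\<in>\<theta> ` {..<n}. of_int (u v) * v) = 0" "\<exists>v\<in>\<theta> ` {..<n}. u v \<noteq> 0"
      by (auto simp: module.dependent_finite[OF module])
    then show False
      using indep'[of "\<lambda>r. u (\<theta> r)"] inj by (auto simp: sum.reindex)
  qed
  then obtain t0 h0 where t0: "\<And>r. r < n \<Longrightarrow> \<bar>t0 * \<theta> r - of_int (h0 r) - y (e r) / (2 * pi)\<bar> < \<delta>"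
    using Kronecker_thm_1[OF _ inj \<open>\<delta> > 0\<close>, of "\<lambda>r. y (e r) / (2 * pi)"] by blast
  \<comment> \<open>The time \<open>t0\<close> may be negative; a nearly periodic time \<open>q * M\<close> moves it beyond \<open>K\<close>.\<close>
  define M where "M = \<bar>K\<bar> + \<bar>t0\<bar> + 1"
  obtain N :: nat where N: "N > 0" "1 / N < \<delta>"
    using \<open>\<delta> > 0\<close> by (metis gr_zeroI inverse_eq_divide real_arch_inverse)
  obtain q p where q: "0 < q" "\<And>r. r < n \<Longrightarrow> \<bar>of_int q * (M * \<theta> r) - of_int (p r)\<bar> < 1 / N"
    using Dirichlet_approx_simult[OF \<open>N > 0\<close>, of n "\<lambda>r. M * \<theta> r"] by metis
  define t where "t = t0 + of_int q * M"
  have "M * 1 \<le> M * of_int q"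
    using q(1) by (intro mult_left_mono) (auto simp: M_def)
  then have "t > K" by (auto simp: t_def M_def mult.commute)
  have *: "\<bar>t * l i - 2 * pi * of_int (h i) - y i\<bar> < \<epsilon>"
    if "h = (\<lambda>i. h0 (inv_into {..<n} e i) + p (inv_into {..<n} e i))" for h i
  proof -
    define r where "r = inv_into {..<n} e i"
    have r: "r < n" "e r = i"
      using bij_betw_apply[OF bij_betw_inv_into[OF e], of i] bij_betw_inv_into_right[OF e, of i]
      by (simp_all add: r_def)
    have "\<bar>t * \<theta> r - of_int (h i) - y i / (2 * pi)\<bar>
        = \<bar>(t0 * \<theta> r - of_int (h0 r) - y (e r) / (2 * pi)) + (of_int q * (M * \<theta> r) - of_int (p r))\<bar>"
      by (simp add: t_def algebra_simps that r flip: r_def)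
    also have "\<dots> < 2 * \<delta>" using t0[OF r(1)] q(2)[OF r(1)] N(2) by linarith
    finally have "2 * pi * \<bar>t * \<theta> r - of_int (h i) - y i / (2 * pi)\<bar> < \<epsilon>"
      by (simp add: \<delta>_def field_simps)
    also have "2 * pi * \<bar>t * \<theta> r - of_int (h i) - y i / (2 * pi)\<bar>
        = \<bar>2 * pi * (t * \<theta> r - of_int (h i) - y i / (2 * pi))\<bar>"
      by (simp add: abs_mult)
    also have "2 * pi * (t * \<theta> r - of_int (h i) - y i / (2 * pi)) = t * l i - 2 * pi * of_int (h i) - y i"
      by (simp add: \<theta>_def r field_simps)
    finally show ?thesis .
  qed
  show thesis by (rule that[OF \<open>t > K\<close> *[OF refl]])
qed

text \<open>
  The function \<open>F (1 / k)\<close> is followed along the line \<open>k \<mapsto> k l\<close>.  For large \<open>k\<close> it is close to the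
  periodic function \<open>F 0\<close>, and at some late time the line passes as close as desired to \<open>y\<close> modulo
  \<open>2 \<pi>\<close>.  Since \<open>F 0\<close> changes sign at \<open>y\<close> in the direction \<open>l\<close>, the intermediate value theorem
  gives a zero there.
\<close>

lemma zeros_along_flow:
  fixes F :: "real \<Rightarrow> real ^ 'n::finite \<Rightarrow> real" and l :: "real ^ 'n"
  assumes indep: "\<And>q :: 'n \<Rightarrow> int. (\<Sum>i\<in>UNIV. of_int (q i) * l $ i) = 0 \<Longrightarrow> \<forall>i. q i = 0"
    and cont: "continuous_on UNIV (\<lambda>(\<epsilon>, x). F \<epsilon> x)"
    and periodic: "\<And>\<epsilon> x h. F \<epsilon> (\<chi> i. x $ i + 2 * pi * of_int (h i)) = F \<epsilon> x"
    and zero: "F 0 y = 0"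
    and deriv: "((\<lambda>t. F 0 (y + t *\<^sub>R l)) has_real_derivative d) (at 0)" and "d \<noteq> 0"
  obtains \<kappa> x h where "filterlim \<kappa> at_top sequentially" "x \<longlonglongrightarrow> y"
    "\<And>n i. \<kappa> n * l $ i = x n $ i + 2 * pi * of_int (h n i)"
    "\<And>n :: nat. F (1 / \<kappa> n) (x n) = 0"
proof -
  have near: "\<exists>k x h. k > K \<and> dist x y < r \<and> F (1 / k) x = 0
      \<and> (\<forall>i. k * l $ i = x $ i + 2 * pi * of_int (h i :: int))" if "r > 0" for K r :: real
  proof -
    \<comment> \<open>Along the flow line through \<open>y\<close> the limit function changes sign within \<open>r / 2\<close> of \<open>y\<close>.\<close>
    define g where "g = (\<lambda>t. F 0 (y + t *\<^sub>R l))"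
    have g: "(g has_real_derivative d) (at 0)" "g 0 = 0"
      using deriv zero by (simp_all add: g_def)
    define b where "b = r / (2 * (norm l + 1))"
    have "b > 0" using \<open>r > 0\<close> by (simp add: b_def add_nonneg_pos)
    obtain s where s: "0 < s" "s < b" "g s * g (- s) < 0"
    proof (cases "d > 0")
      case True
      obtain d1 where d1: "d1 > 0" "\<And>h. 0 < h \<Longrightarrow> h < d1 \<Longrightarrow> g 0 < g (0 + h)"
        using DERIV_pos_inc_right[OF g(1) True] by metis
      obtain d2 where d2: "d2 > 0" "\<And>h. 0 < h \<Longrightarrow> h < d2 \<Longrightarrow> g (0 - h) < g 0"
        using DERIV_pos_inc_left[OF g(1) True] by metis
      define s where "s = min b (min d1 d2) / 2"
      have "s > 0" "s < b" "s < d1" "s < d2" using \<open>b > 0\<close> d1(1) d2(1) by (auto simp: s_def)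
      with d1(2)[of s] d2(2)[of s] show thesis
        by (intro that[of s]) (auto simp: g(2) mult_pos_neg)
    next
      case False
      then have "d < 0" using \<open>d \<noteq> 0\<close> by simp
      obtain d1 where d1: "d1 > 0" "\<And>h. 0 < h \<Longrightarrow> h < d1 \<Longrightarrow> g 0 > g (0 + h)"
        using DERIV_neg_dec_right[OF g(1) \<open>d < 0\<close>] by metis
      obtain d2 where d2: "d2 > 0" "\<And>h. 0 < h \<Longrightarrow> h < d2 \<Longrightarrow> g (0 - h) > g 0"
        using DERIV_neg_dec_left[OF g(1) \<open>d < 0\<close>] by metis
      define s where "s = min b (min d1 d2) / 2"
      have "s > 0" "s < b" "s < d1" "s < d2" using \<open>b > 0\<close> d1(1) d2(1) by (auto simp: s_def)
      with d1(2)[of s] d2(2)[of s] show thesis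
        by (intro that[of s]) (auto simp: g(2) mult_neg_pos)
    qed
    \<comment> \<open>The sign change survives for large \<open>k\<close> and for starting points \<open>z\<close> near \<open>y\<close>.\<close>
    define c where "c = (\<lambda>(k, z). F (1 / (k + s)) (z + s *\<^sub>R l) * F (1 / (k - s)) (z - s *\<^sub>R l))"
    have cF: "((\<lambda>u. F (a u) (w u)) \<longlongrightarrow> F a0 w0) U" if "(a \<longlongrightarrow> a0) U" "(w \<longlongrightarrow> w0) U"
      for a w a0 w0 and U :: "(real \<times> (real ^ 'n)) filter"
      using continuous_on_tendsto_compose[OF cont tendsto_Pair[OF that]] by simp
    have fst: "filterlim fst at_top (at_top \<times>\<^sub>F nhds y)"
      by (rule filterlim_fst)
    have "filterlim (\<lambda>u. fst u + s) at_top (at_top \<times>\<^sub>F nhds y)"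
      "filterlim (\<lambda>u. fst u - s) at_top (at_top \<times>\<^sub>F nhds y)"
      using filterlim_tendsto_add_at_top[OF tendsto_const[of s] fst]
        filterlim_tendsto_add_at_top[OF tendsto_const[of "- s"] fst] by (simp_all add: add.commute)
    from this[THEN real_tendsto_divide_at_top[OF tendsto_const]]
    have "(c \<longlongrightarrow> F 0 (y + s *\<^sub>R l) * F 0 (y - s *\<^sub>R l)) (at_top \<times>\<^sub>F nhds y)"
      unfolding c_def case_prod_beta
      by (intro tendsto_mult cF tendsto_add tendsto_diff filterlim_snd tendsto_const)
    moreover have "F 0 (y + s *\<^sub>R l) * F 0 (y - s *\<^sub>R l) < 0" using s(3) by (simp add: g_def)
    ultimately have "eventually (\<lambda>u. c u < 0) (at_top \<times>\<^sub>F nhds y)"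
      by (rule order_tendstoD)
    then obtain P Q where PQ: "eventually P at_top" "eventually Q (nhds y)" "\<And>k z. P k \<Longrightarrow> Q z \<Longrightarrow> c (k, z) < 0"
      unfolding eventually_prod_filter by blast
    obtain K1 where K1: "\<And>k. k \<ge> K1 \<Longrightarrow> P k" using PQ(1) by (auto simp: eventually_at_top_linorder)
    obtain \<rho> where \<rho>: "\<rho> > 0" "\<And>z. dist z y < \<rho> \<Longrightarrow> Q z" using PQ(2) by (auto simp: eventually_nhds_metric)
    define \<eta> where "\<eta> = min \<rho> (r / 2)"
    have "\<eta> > 0" using \<rho> \<open>r > 0\<close> by (simp add: \<eta>_def)
    obtain k h where k: "k > max (max K1 K) 0 + s"
        "\<And>i. \<bar>k * l $ i - 2 * pi * of_int (h i) - y $ i\<bar> < \<eta> / CARD('n)"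
      using kronecker_flow[OF indep, where y="\<lambda>i. y $ i" and \<epsilon>="\<eta> / CARD('n)" and K="max (max K1 K) 0 + s"] \<open>\<eta> > 0\<close> by auto
    define z where "z = (\<chi> i. k * l $ i - 2 * pi * of_int (h i))"
    have "dist z y \<le> (\<Sum>i\<in>UNIV. \<bar>(z - y) $ i\<bar>)" unfolding dist_norm by (rule norm_le_l1_cart)
    also have "\<dots> < (\<Sum>i\<in>(UNIV :: 'n set). \<eta> / CARD('n))"
      using k(2) by (intro sum_strict_mono) (auto simp: z_def)
    finally have zy: "dist z y < \<eta>" by simp
    have "c (k, z) < 0" using PQ(3)[OF K1 \<rho>(2)] k(1) zy s by (auto simp: \<eta>_def)
    define G where "G = (\<lambda>t. F (1 / (k + t)) (z + t *\<^sub>R l))"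
    have "G s * G (- s) < 0" using \<open>c (k, z) < 0\<close> by (simp add: c_def G_def)
    have "continuous_on {-s..s} G"
      unfolding G_def
      by (rule continuous_on_compose2[OF cont, of _ "\<lambda>t. (1 / (k + t), z + t *\<^sub>R l)", simplified])
        (use k(1) s in \<open>auto intro!: continuous_intros\<close>)
    moreover have "(G (-s) \<le> 0 \<and> 0 \<le> G s) \<or> (G s \<le> 0 \<and> 0 \<le> G (-s))"
      using \<open>G s * G (- s) < 0\<close> by (auto simp: mult_less_0_iff)
    ultimately have "\<exists>t\<ge>-s. t \<le> s \<and> G t = 0"
      using IVT'[of G "-s" 0 s] IVT2'[of G s 0 "-s"] s(1) by auto
    then obtain t where t: "-s \<le> t" "t \<le> s" "G t = 0" by blast
    have "norm (t *\<^sub>R l) \<le> b * (norm l + 1)"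
      using t s by (auto intro!: mult_mono)
    also have "\<dots> = r / 2"
      using norm_ge_zero[of l] by (simp add: b_def divide_simps del: norm_ge_zero)
    finally have "norm (t *\<^sub>R l) \<le> r / 2" .
    then have "dist (z + t *\<^sub>R l) y < r"
      using zy dist_triangle[of "z + t *\<^sub>R l" y z] by (auto simp: \<eta>_def dist_norm)
    moreover have "k + t > K" using k t s by auto
    ultimately show ?thesis
      using t(3) by (intro exI[of _ "k + t"] exI[of _ "z + t *\<^sub>R l"] exI[of _ h])
        (auto simp: G_def z_def algebra_simps)
  qed
  define P where "P = (\<lambda>n k x h. k > real n \<and> dist x y < 1 / real (Suc n) \<and> F (1 / k) x = 0
      \<and> (\<forall>i. k * l $ i = x $ i + 2 * pi * of_int (h i :: int)))"
  have "\<forall>n. \<exists>k x h. P n k x h"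
    unfolding P_def by (intro allI near) simp
  from choice[OF this] obtain \<kappa> where "\<forall>n. \<exists>x h. P n (\<kappa> n) x h" ..
  from choice[OF this] obtain x where "\<forall>n. \<exists>h. P n (\<kappa> n) (x n) h" ..
  from choice[OF this] obtain h where "\<forall>n. P n (\<kappa> n) (x n) (h n)" ..
  then have *: "\<And>n. \<kappa> n > real n" "\<And>n. dist (x n) y < 1 / real (Suc n)"
      "\<And>n. F (1 / \<kappa> n) (x n) = 0" "\<And>n i. \<kappa> n * l $ i = x n $ i + 2 * pi * of_int (h n i)"
    by (auto simp: P_def)
  show thesis
  proof (rule that[of \<kappa> x h])
    show "filterlim \<kappa> at_top sequentially"
      by (rule filterlim_at_top_mono[OF filterlim_real_sequentially]) (simp add: *(1) less_imp_le)
    show "x \<longlonglongrightarrow> y"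
    proof (rule metric_LIMSEQ_I)
      fix r :: real assume "r > 0"
      then obtain N :: nat where "N > 0" "1 / N < r" by (metis gr_zeroI inverse_eq_divide real_arch_inverse)
      then have "dist (x n) y < r" if "n \<ge> N" for n
      proof -
        have "1 / real (Suc n) \<le> 1 / N" using that \<open>N > 0\<close> by (simp add: frac_le)
        with *(2)[of n] \<open>1 / N < r\<close> show ?thesis by linarith
      qed
      then show "\<exists>N. \<forall>n\<ge>N. dist (x n) y < r" by blast
    qed
  qed (use * in auto)
qed

section \<open>Comparison of two secular functions at high energy\<close>

lemma tendsto_secular_form:
  assumes "(a1 \<longlongrightarrow> a1') F" "(a2 \<longlongrightarrow> a2') F" "(q3 \<longlongrightarrow> q3') F" "(q4 \<longlongrightarrow> q4') F"
    and "(x1 \<longlongrightarrow> x1') F" "(x2 \<longlongrightarrow> x2') F" "(x3 \<longlongrightarrow> x3') F" "(x4 \<longlongrightarrow> x4') F"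
  shows "((\<lambda>u. secular_form (a1 u) (a2 u) p3 (q3 u) p4 (q4 u) (x1 u) (x2 u) (x3 u) (x4 u))
    \<longlongrightarrow> secular_form a1' a2' p3 q3' p4 q4' x1' x2' x3' x4') F"
  unfolding secular_form_def Let_def
  by (intro tendsto_intros isCont_tendsto_compose[OF isCont_sin] isCont_tendsto_compose[OF isCont_cos] assms)

text \<open>
  The secular form is affine in each vertex parameter, so its increments are products of a parameter
  difference with a slope.  Applied to one parameter after the other, this expands the difference
  of two secular functions.
\<close>

lemma secular_form_affine:
  shows "secular_form a1 a2 p3 q3 p4 q4 x1 x2 x3 x4 - secular_form a1' a2 p3 q3 p4 q4 x1 x2 x3 x4
      = (a1 - a1') * (secular_form 1 a2 p3 q3 p4 q4 x1 x2 x3 x4 - secular_form 0 a2 p3 q3 p4 q4 x1 x2 x3 x4)"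
    and "secular_form a1 a2 p3 q3 p4 q4 x1 x2 x3 x4 - secular_form a1 a2' p3 q3 p4 q4 x1 x2 x3 x4
      = (a2 - a2') * (secular_form a1 1 p3 q3 p4 q4 x1 x2 x3 x4 - secular_form a1 0 p3 q3 p4 q4 x1 x2 x3 x4)"
    and "secular_form a1 a2 p3 q3 p4 q4 x1 x2 x3 x4 - secular_form a1 a2 p3 q3' p4 q4 x1 x2 x3 x4
      = (q3 - q3') * (secular_form a1 a2 p3 1 p4 q4 x1 x2 x3 x4 - secular_form a1 a2 p3 0 p4 q4 x1 x2 x3 x4)"
    and "secular_form a1 a2 p3 q3 p4 q4 x1 x2 x3 x4 - secular_form a1 a2 p3 q3 p4 q4' x1 x2 x3 x4
      = (q4 - q4') * (secular_form a1 a2 p3 q3 p4 1 x1 x2 x3 x4 - secular_form a1 a2 p3 q3 p4 0 x1 x2 x3 x4)"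
  unfolding secular_form_def Let_def by algebra+

lemma secular_periodic: "secular \<alpha> \<epsilon> (\<chi> i. x $ i + 2 * pi * of_int (h i)) = secular \<alpha> \<epsilon> x"
proof -
  have "sin (t + 2 * pi * of_int n) = sin t" "cos (t + 2 * pi * of_int n) = cos t" for t and n :: int
    using sin_int_2pin[of n] cos_int_2pin[of n] by (simp_all add: sin_add cos_add)
  then show ?thesis by (simp add: secular_def secular_form_def sin_add cos_add)
qed

lemma tendsto_coupling_q:
  assumes "(\<epsilon> \<longlongrightarrow> \<epsilon>0) F"
  shows "((\<lambda>u. coupling_q (\<epsilon> u) \<alpha>) \<longlongrightarrow> coupling_q \<epsilon>0 \<alpha>) F"
  unfolding coupling_q_def using assms by (auto intro!: tendsto_intros)

lemma continuous_on_secular: "continuous_on UNIV (\<lambda>(\<epsilon>, x). secular \<alpha> \<epsilon> x)"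
  unfolding continuous_on_def case_prod_beta secular_def
  by (intro ballI tendsto_secular_form tendsto_coupling_q tendsto_mult tendsto_vec_nth tendsto_fst
      tendsto_snd tendsto_const tendsto_ident_at)

text \<open>
  The derivative of the leading term of the secular function in the direction of the flow
  \<open>k \<mapsto> k l\<close>; a zero of the leading term is visible in the spectrum when this is nonzero.
\<close>

definition flow_derivative ::
    "real ^ 4 \<Rightarrow> real \<Rightarrow> real \<Rightarrow> real \<Rightarrow> real \<Rightarrow> real \<Rightarrow> real \<Rightarrow> real \<Rightarrow> real \<Rightarrow> real" where
  "flow_derivative l p3 q3 p4 q4 y1 y2 y3 y4 =
    (let A = cos y1; B = sin y1; P = q4 * sin y4 - p4 * cos y4; Q = q4 * cos y4 + p4 * sin y4;
         V = q3 * P - p3 * Q; V' = l $ 4 * (q3 * Q + p3 * P);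
         C' = - l $ 2 * (sin y2 * cos y3) - l $ 3 * (cos y2 * sin y3)
     in (l $ 1 * A * V + B * V') * (cos y2 * cos y3) + B * V * C'
        + (q3 * (l $ 1 * A * Q - l $ 4 * B * P) - l $ 1 * B * V + A * V') * sin (y2 + y3)
        + (l $ 2 + l $ 3) * (q3 * B * Q + A * V) * cos (y2 + y3)
        + 2 * q3 * (l $ 1 * B * Q + l $ 4 * A * P) * (1 + cos (y2 + y3))
        + 2 * q3 * A * Q * (l $ 2 + l $ 3) * sin (y2 + y3))"

lemma secular_form_flow_derivative:
  "((\<lambda>t. secular_form 0 0 p3 q3 p4 q4 (y1 + t * l $ 1) (y2 + t * l $ 2) (y3 + t * l $ 3) (y4 + t * l $ 4))
    has_real_derivative flow_derivative l p3 q3 p4 q4 y1 y2 y3 y4) (at 0)"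
proof -
  define A B where "A = (\<lambda>t. cos (y1 + t * l $ 1))" and "B = (\<lambda>t. sin (y1 + t * l $ 1))"
  define P Q where "P = (\<lambda>t. q4 * sin (y4 + t * l $ 4) - p4 * cos (y4 + t * l $ 4))"
    and "Q = (\<lambda>t. q4 * cos (y4 + t * l $ 4) + p4 * sin (y4 + t * l $ 4))"
  define C where "C = (\<lambda>t. cos (y2 + t * l $ 2) * cos (y3 + t * l $ 3))"
  define S K where "S = (\<lambda>t. sin (y2 + t * l $ 2 + (y3 + t * l $ 3)))"
    and "K = (\<lambda>t. cos (y2 + t * l $ 2 + (y3 + t * l $ 3)))"
  define C' where "C' = - l $ 2 * (sin y2 * cos y3) - l $ 3 * (cos y2 * sin y3)"
  have AB: "(A has_real_derivative - l $ 1 * B 0) (at 0)" "(B has_real_derivative l $ 1 * A 0) (at 0)"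
    unfolding A_def B_def by (auto intro!: derivative_eq_intros)
  have PQ: "(P has_real_derivative l $ 4 * Q 0) (at 0)" "(Q has_real_derivative - l $ 4 * P 0) (at 0)"
    unfolding P_def Q_def by (auto intro!: derivative_eq_intros simp: algebra_simps)
  have C: "(C has_real_derivative C') (at 0)"
    unfolding C_def C'_def by (auto intro!: derivative_eq_intros)
  have SK: "(S has_real_derivative (l $ 2 + l $ 3) * K 0) (at 0)"
    "(K has_real_derivative - (l $ 2 + l $ 3) * S 0) (at 0)"
    unfolding S_def K_def by (auto intro!: derivative_eq_intros simp: algebra_simps)
  have "((\<lambda>t. B t * (q3 * P t - p3 * Q t) * C t + (q3 * B t * Q t + A t * (q3 * P t - p3 * Q t)) * S t
      - 2 * q3 * A t * Q t * (1 + K t)) has_real_derivative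
      (l $ 1 * A 0 * (q3 * P 0 - p3 * Q 0) + B 0 * (l $ 4 * (q3 * Q 0 + p3 * P 0))) * C 0
      + B 0 * (q3 * P 0 - p3 * Q 0) * C'
      + (q3 * (l $ 1 * A 0 * Q 0 - l $ 4 * B 0 * P 0) - l $ 1 * B 0 * (q3 * P 0 - p3 * Q 0)
         + A 0 * (l $ 4 * (q3 * Q 0 + p3 * P 0))) * S 0
      + (l $ 2 + l $ 3) * (q3 * B 0 * Q 0 + A 0 * (q3 * P 0 - p3 * Q 0)) * K 0
      + 2 * q3 * (l $ 1 * B 0 * Q 0 + l $ 4 * A 0 * P 0) * (1 + K 0)
      + 2 * q3 * A 0 * Q 0 * (l $ 2 + l $ 3) * S 0) (at 0)"
    by (rule derivative_eq_intros AB PQ C SK refl)+ algebra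
  then show ?thesis
    by (simp add: secular_form_def flow_derivative_def Let_def A_def B_def P_def Q_def C_def C'_def S_def K_def)
qed

definition point :: "real \<Rightarrow> real \<Rightarrow> real \<Rightarrow> real \<Rightarrow> real ^ 4" where
  "point y1 y2 y3 y4 = (\<chi> i. if i = 1 then y1 else if i = 2 then y2 else if i = 3 then y3 else y4)"

lemma point_nth [simp]:
  "point y1 y2 y3 y4 $ 1 = y1" "point y1 y2 y3 y4 $ 2 = y2"
  "point y1 y2 y3 y4 $ 3 = y3" "point y1 y2 y3 y4 $ 4 = y4"
  by (simp_all add: point_def)

text \<open>
  This is the step from the spectrum to the coupling constants.  At a transversal zero \<open>y\<close> of the
  leading term for \<open>\<alpha>\<close> there are \<open>k\<^sub>n \<rightarrow> \<infinity>\<close> with phases tending to \<open>y\<close> at which both secular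
  functions vanish.  In the limit the leading term for \<open>\<alpha>'\<close> vanishes at \<open>y\<close>.  If the leading terms
  are equal, the difference of the secular functions is divisible by \<open>1 / k\<close>, and the limit of the
  quotient is the second conclusion: a linear equation for the differences of \<open>\<alpha>\<^sub>1\<close>, \<open>\<alpha>\<^sub>2\<close>,
  \<open>1 / \<alpha>\<^sub>3\<close>, \<open>1 / \<alpha>\<^sub>4\<close>.  A vanishing \<open>\<alpha>\<^sub>i\<close> is covered by the convention \<open>1 / 0 = 0\<close>.
\<close>

lemma secular_comparison:
  fixes l :: "real ^ 4" and \<alpha> \<alpha>' :: "nat \<Rightarrow> real"
  assumes indep: "\<forall>q :: 4 \<Rightarrow> int. (\<Sum>i\<in>UNIV. of_int (q i) * l $ i) = 0 \<longrightarrow> (\<forall>i. q i = 0)"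
    and common: "\<forall>k>0. cos (k * l $ 2) \<noteq> 0 \<and> cos (k * l $ 3) \<noteq> 0 \<and>
      secular \<alpha> (1 / k) (k *\<^sub>R l) = 0 \<longrightarrow> secular \<alpha>' (1 / k) (k *\<^sub>R l) = 0"
  defines "p3 \<equiv> coupling_p (\<alpha> 3)" and "q3 \<equiv> coupling_q 0 (\<alpha> 3)"
    and "p4 \<equiv> coupling_p (\<alpha> 4)" and "q4 \<equiv> coupling_q 0 (\<alpha> 4)"
  assumes zero: "secular_form 0 0 p3 q3 p4 q4 y1 y2 y3 y4 = 0"
    and transversal: "flow_derivative l p3 q3 p4 q4 y1 y2 y3 y4 \<noteq> 0"
    and cos23: "cos y2 \<noteq> 0" "cos y3 \<noteq> 0"
  shows "secular_form 0 0 (coupling_p (\<alpha>' 3)) (coupling_q 0 (\<alpha>' 3)) (coupling_p (\<alpha>' 4))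
      (coupling_q 0 (\<alpha>' 4)) y1 y2 y3 y4 = 0" (is ?zero)
    and "coupling_p (\<alpha>' 3) = p3 \<Longrightarrow> coupling_p (\<alpha>' 4) = p4 \<Longrightarrow>
      (\<alpha> 1 - \<alpha>' 1) * (secular_form 1 0 p3 q3 p4 q4 y1 y2 y3 y4 - secular_form 0 0 p3 q3 p4 q4 y1 y2 y3 y4)
      + (\<alpha> 2 - \<alpha>' 2) * (secular_form 0 1 p3 q3 p4 q4 y1 y2 y3 y4 - secular_form 0 0 p3 q3 p4 q4 y1 y2 y3 y4)
      + (1 / \<alpha> 3 - 1 / \<alpha>' 3) * (secular_form 0 0 p3 1 p4 q4 y1 y2 y3 y4 - secular_form 0 0 p3 0 p4 q4 y1 y2 y3 y4)
      + (1 / \<alpha> 4 - 1 / \<alpha>' 4) * (secular_form 0 0 p3 q3 p4 1 y1 y2 y3 y4 - secular_form 0 0 p3 q3 p4 0 y1 y2 y3 y4)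
      = 0" (is "_ \<Longrightarrow> _ \<Longrightarrow> ?first_order = 0")
proof -
  define y where "y = point y1 y2 y3 y4"
  have "secular \<alpha> 0 y = 0" using zero by (simp add: secular_def y_def p3_def q3_def p4_def q4_def)
  moreover have "((\<lambda>t. secular \<alpha> 0 (y + t *\<^sub>R l)) has_real_derivative
      flow_derivative l p3 q3 p4 q4 y1 y2 y3 y4) (at 0)"
    using secular_form_flow_derivative[of p3 q3 p4 q4 y1 l y2 y3 y4] by (simp add: secular_def y_def p3_def q3_def p4_def q4_def)
  ultimately obtain \<kappa> x h where \<kappa>: "filterlim \<kappa> at_top sequentially" and x: "x \<longlonglongrightarrow> y"
    and \<kappa>l: "\<And>n i. \<kappa> n * l $ i = x n $ i + 2 * pi * of_int (h n i)"
    and zeros: "\<And>n :: nat. secular \<alpha> (1 / \<kappa> n) (x n) = 0"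
    using zeros_along_flow[where F = "secular \<alpha>" and l = l and y = y 
          and d = "flow_derivative l p3 q3 p4 q4 y1 y2 y3 y4",
        OF indep[THEN spec, THEN mp] continuous_on_secular secular_periodic _ _ transversal] by blast
  have xi: "(\<lambda>n. x n $ i) \<longlonglongrightarrow> y $ i" for i using x by (rule tendsto_vec_nth)
  have \<epsilon>: "(\<lambda>n. 1 / \<kappa> n) \<longlonglongrightarrow> 0" using \<kappa> by (rule real_tendsto_divide_at_top[OF tendsto_const])
  have cos_x: "cos (\<kappa> n * l $ i) = cos (x n $ i)" for n i
    unfolding \<kappa>l using sin_int_2pin[of "h n i"] cos_int_2pin[of "h n i"] by (simp add: cos_add)
  have nonzero: "eventually (\<lambda>n. cos (\<kappa> n * l $ i) \<noteq> 0) sequentially" if "cos (y $ i) \<noteq> 0" for i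
    unfolding cos_x using that by (intro tendsto_imp_eventually_ne[OF tendsto_cos[OF xi]])
  have \<kappa>_vec: "\<kappa> n *\<^sub>R l = (\<chi> i. x n $ i + 2 * pi * of_int (h n i))" for n
    by (simp add: vec_eq_iff \<kappa>l)
  have zeros': "eventually (\<lambda>n. \<kappa> n > 0 \<and> secular \<alpha>' (1 / \<kappa> n) (x n) = 0) sequentially"
  proof -
    have "eventually (\<lambda>n. \<kappa> n > 0) sequentially" using \<kappa> by (simp add: filterlim_at_top_dense)
    moreover have "eventually (\<lambda>n. cos (\<kappa> n * l $ 2) \<noteq> 0) sequentially"
      "eventually (\<lambda>n. cos (\<kappa> n * l $ 3) \<noteq> 0) sequentially"
      using nonzero[of 2] nonzero[of 3] cos23 by (simp_all add: y_def)
    ultimately show ?thesis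
    proof eventually_elim
      case (elim n)
      then show ?case
        using common[rule_format, of "\<kappa> n"] zeros[of n] unfolding \<kappa>_vec secular_periodic by simp
    qed
  qed
  have "(\<lambda>n. secular \<alpha>' (1 / \<kappa> n) (x n)) \<longlonglongrightarrow> secular \<alpha>' 0 y"
    using continuous_on_tendsto_compose[OF continuous_on_secular tendsto_Pair[OF \<epsilon> x]] by simp
  moreover have "(\<lambda>n. secular \<alpha>' (1 / \<kappa> n) (x n)) \<longlonglongrightarrow> 0"
    using zeros' by (intro tendsto_eventually) (auto elim: eventually_mono)
  ultimately have "secular \<alpha>' 0 y = 0" by (rule LIMSEQ_unique)
  then show ?zero by (simp add: secular_def y_def)
  assume p': "coupling_p (\<alpha>' 3) = p3" "coupling_p (\<alpha>' 4) = p4"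
  define f where "f = (\<lambda>a1 a2 q3 q4 x :: real ^ 4.
    secular_form a1 a2 p3 q3 p4 q4 (x $ 1) (x $ 2) (x $ 3) (x $ 4))"
  define Q where "Q = (\<lambda>i \<epsilon>. coupling_q \<epsilon> (\<alpha> i))"
  define Q' where "Q' = (\<lambda>i \<epsilon>. coupling_q \<epsilon> (\<alpha>' i))"
  have QQ': "Q i \<epsilon> - Q' i \<epsilon> = \<epsilon> * (1 / \<alpha> i - 1 / \<alpha>' i)" if "i = 3 \<or> i = 4" for i \<epsilon>
    using p' that by (auto simp: Q_def Q'_def p3_def p4_def coupling_p_def coupling_q_def
        algebra_simps split: if_splits)
  define H where "H = (\<lambda>\<epsilon> x.
      (\<alpha> 1 - \<alpha>' 1) * (f 1 (\<epsilon> * \<alpha> 2) (Q 3 \<epsilon>) (Q 4 \<epsilon>) x - f 0 (\<epsilon> * \<alpha> 2) (Q 3 \<epsilon>) (Q 4 \<epsilon>) x)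
    + (\<alpha> 2 - \<alpha>' 2) * (f (\<epsilon> * \<alpha>' 1) 1 (Q 3 \<epsilon>) (Q 4 \<epsilon>) x - f (\<epsilon> * \<alpha>' 1) 0 (Q 3 \<epsilon>) (Q 4 \<epsilon>) x)
    + (1 / \<alpha> 3 - 1 / \<alpha>' 3) * (f (\<epsilon> * \<alpha>' 1) (\<epsilon> * \<alpha>' 2) 1 (Q 4 \<epsilon>) x - f (\<epsilon> * \<alpha>' 1) (\<epsilon> * \<alpha>' 2) 0 (Q 4 \<epsilon>) x)
    + (1 / \<alpha> 4 - 1 / \<alpha>' 4) * (f (\<epsilon> * \<alpha>' 1) (\<epsilon> * \<alpha>' 2) (Q' 3 \<epsilon>) 1 x - f (\<epsilon> * \<alpha>' 1) (\<epsilon> * \<alpha>' 2) (Q' 3 \<epsilon>) 0 x))"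
  \<comment> \<open>The parameters of \<open>\<alpha>\<close> are exchanged for those of \<open>\<alpha>'\<close> one at a time.\<close>
  have diff: "secular \<alpha> \<epsilon> x - secular \<alpha>' \<epsilon> x = \<epsilon> * H \<epsilon> x" for \<epsilon> x
  proof -
    have "secular \<alpha> \<epsilon> x - secular \<alpha>' \<epsilon> x = f (\<epsilon> * \<alpha> 1) (\<epsilon> * \<alpha> 2) (Q 3 \<epsilon>) (Q 4 \<epsilon>) x
        - f (\<epsilon> * \<alpha>' 1) (\<epsilon> * \<alpha>' 2) (Q' 3 \<epsilon>) (Q' 4 \<epsilon>) x"
      by (simp add: secular_def f_def Q_def Q'_def p' p3_def p4_def)
    also have "\<dots> = (f (\<epsilon> * \<alpha> 1) (\<epsilon> * \<alpha> 2) (Q 3 \<epsilon>) (Q 4 \<epsilon>) x - f (\<epsilon> * \<alpha>' 1) (\<epsilon> * \<alpha> 2) (Q 3 \<epsilon>) (Q 4 \<epsilon>) x)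
        + (f (\<epsilon> * \<alpha>' 1) (\<epsilon> * \<alpha> 2) (Q 3 \<epsilon>) (Q 4 \<epsilon>) x - f (\<epsilon> * \<alpha>' 1) (\<epsilon> * \<alpha>' 2) (Q 3 \<epsilon>) (Q 4 \<epsilon>) x)
        + (f (\<epsilon> * \<alpha>' 1) (\<epsilon> * \<alpha>' 2) (Q 3 \<epsilon>) (Q 4 \<epsilon>) x - f (\<epsilon> * \<alpha>' 1) (\<epsilon> * \<alpha>' 2) (Q' 3 \<epsilon>) (Q 4 \<epsilon>) x)
        + (f (\<epsilon> * \<alpha>' 1) (\<epsilon> * \<alpha>' 2) (Q' 3 \<epsilon>) (Q 4 \<epsilon>) x - f (\<epsilon> * \<alpha>' 1) (\<epsilon> * \<alpha>' 2) (Q' 3 \<epsilon>) (Q' 4 \<epsilon>) x)"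
      by simp
    also have "\<dots> = (\<epsilon> * \<alpha> 1 - \<epsilon> * \<alpha>' 1) * (f 1 (\<epsilon> * \<alpha> 2) (Q 3 \<epsilon>) (Q 4 \<epsilon>) x - f 0 (\<epsilon> * \<alpha> 2) (Q 3 \<epsilon>) (Q 4 \<epsilon>) x)
        + (\<epsilon> * \<alpha> 2 - \<epsilon> * \<alpha>' 2) * (f (\<epsilon> * \<alpha>' 1) 1 (Q 3 \<epsilon>) (Q 4 \<epsilon>) x - f (\<epsilon> * \<alpha>' 1) 0 (Q 3 \<epsilon>) (Q 4 \<epsilon>) x)
        + (Q 3 \<epsilon> - Q' 3 \<epsilon>) * (f (\<epsilon> * \<alpha>' 1) (\<epsilon> * \<alpha>' 2) 1 (Q 4 \<epsilon>) x - f (\<epsilon> * \<alpha>' 1) (\<epsilon> * \<alpha>' 2) 0 (Q 4 \<epsilon>) x)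
        + (Q 4 \<epsilon> - Q' 4 \<epsilon>) * (f (\<epsilon> * \<alpha>' 1) (\<epsilon> * \<alpha>' 2) (Q' 3 \<epsilon>) 1 x - f (\<epsilon> * \<alpha>' 1) (\<epsilon> * \<alpha>' 2) (Q' 3 \<epsilon>) 0 x)"
      unfolding f_def by (intro arg_cong2[where f = "(+)"] secular_form_affine)
    also have "\<dots> = \<epsilon> * H \<epsilon> x"
      by (simp only: QQ' H_def refl simp_thms) (simp only: algebra_simps)
    finally show ?thesis .
  qed
  have Q: "(\<lambda>n. Q i (1 / \<kappa> n)) \<longlonglongrightarrow> Q i 0" "(\<lambda>n. Q' i (1 / \<kappa> n)) \<longlonglongrightarrow> Q' i 0" for i
    unfolding Q_def Q'_def by (intro tendsto_coupling_q \<epsilon>)+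
  have a: "(\<lambda>n. 1 / \<kappa> n * c) \<longlonglongrightarrow> 0" for c using tendsto_mult_right[OF \<epsilon>, of c] by simp
  have f: "(\<lambda>n. f (a1 n) (a2 n) (q3 n) (q4 n) (x n)) \<longlonglongrightarrow> f b1 b2 r3 r4 y"
    if "a1 \<longlonglongrightarrow> b1" "a2 \<longlonglongrightarrow> b2" "q3 \<longlonglongrightarrow> r3" "q4 \<longlonglongrightarrow> r4" for a1 a2 q3 q4 b1 b2 r3 r4
    unfolding f_def by (intro tendsto_secular_form that xi)
  have Q0: "Q 3 0 = q3" "Q 4 0 = q4" "Q' 3 0 = q3"
    using p' by (auto simp: Q_def Q'_def q3_def q4_def p3_def coupling_p_def coupling_q_def split: if_splits)
  note Qs = Q(1)[of 3, unfolded Q0] Q(1)[of 4, unfolded Q0] Q(2)[of 3, unfolded Q0]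
  have first_order: "?first_order =
      (\<alpha> 1 - \<alpha>' 1) * (f 1 0 q3 q4 y - f 0 0 q3 q4 y) + (\<alpha> 2 - \<alpha>' 2) * (f 0 1 q3 q4 y - f 0 0 q3 q4 y)
      + (1 / \<alpha> 3 - 1 / \<alpha>' 3) * (f 0 0 1 q4 y - f 0 0 0 q4 y)
      + (1 / \<alpha> 4 - 1 / \<alpha>' 4) * (f 0 0 q3 1 y - f 0 0 q3 0 y)"
    by (simp add: f_def y_def)
  have "(\<lambda>n. H (1 / \<kappa> n) (x n)) \<longlonglongrightarrow> ?first_order"
    unfolding H_def first_order
    by (intro tendsto_add tendsto_mult tendsto_diff tendsto_const f a Qs)
  moreover have "(\<lambda>n. H (1 / \<kappa> n) (x n)) \<longlonglongrightarrow> 0"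
  proof (intro tendsto_eventually eventually_mono[OF zeros'])
    fix n assume "\<kappa> n > 0 \<and> secular \<alpha>' (1 / \<kappa> n) (x n) = 0"
    then show "H (1 / \<kappa> n) (x n) = 0" using diff[of "1 / \<kappa> n" "x n"] zeros[of n] by simp
  qed
  ultimately show "?first_order = 0" by (rule LIMSEQ_unique)
qed

section \<open>Determination of the coupling constants\<close>

text \<open>
  The phases \<open>y\<close> are chosen so that the linear equations become triangular.  When
  \<open>cos y\<^sub>2 + cos y\<^sub>3 = 0\<close>, the determinant of the \<open>2 \<times> 2\<close> system loses its off-diagonal part, and the
  secular form factors into a part depending on edge 1 and a part depending on edge 4.  The pairs
  \<open>(0, \<pi>)\<close> and \<open>(\<pi> / 4, 5 \<pi> / 4)\<close> for \<open>(y\<^sub>2, y\<^sub>3)\<close> have this property.  A zero of the second factor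
  at the latter pair identifies which of \<open>\<alpha>\<^sub>3\<close>, \<open>\<alpha>\<^sub>4\<close> vanish, that is, the leading term.  Zeros of
  the first factor at both pairs give two independent equations for the differences of \<open>\<alpha>\<^sub>1\<close> and
  \<open>\<alpha>\<^sub>2\<close>.  The phases \<open>(0, 0)\<close>, where the two parts interact, then give \<open>\<alpha>\<^sub>3\<close>, and a zero of the
  second factor at \<open>(0, \<pi>)\<close> gives \<open>\<alpha>\<^sub>4\<close>.
\<close>

lemma coupling_constants_determined:
  fixes l :: "real ^ 4" and \<alpha> \<alpha>' :: "nat \<Rightarrow> real"
  assumes indep: "\<forall>q :: 4 \<Rightarrow> int. (\<Sum>i\<in>UNIV. of_int (q i) * l $ i) = 0 \<longrightarrow> (\<forall>i. q i = 0)"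
    and pos: "\<And>i. l $ i > 0"
    and common: "\<forall>k>0. cos (k * l $ 2) \<noteq> 0 \<and> cos (k * l $ 3) \<noteq> 0 \<and>
      secular \<alpha> (1 / k) (k *\<^sub>R l) = 0 \<longrightarrow> secular \<alpha>' (1 / k) (k *\<^sub>R l) = 0"
  shows "\<alpha> 1 = \<alpha>' 1 \<and> \<alpha> 2 = \<alpha>' 2 \<and> \<alpha> 3 = \<alpha>' 3 \<and> \<alpha> 4 = \<alpha>' 4"
proof -
  define p3 q3 p4 q4 where "p3 = coupling_p (\<alpha> 3)" and "q3 = coupling_q 0 (\<alpha> 3)"
    and "p4 = coupling_p (\<alpha> 4)" and "q4 = coupling_q 0 (\<alpha> 4)"
  define p3' q3' p4' q4' where "p3' = coupling_p (\<alpha>' 3)" and "q3' = coupling_q 0 (\<alpha>' 3)"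
    and "p4' = coupling_p (\<alpha>' 4)" and "q4' = coupling_q 0 (\<alpha>' 4)"
  note defs = p3_def q3_def p4_def q4_def and defs' = p3'_def q3'_def p4'_def q4'_def
  have pq: "p3 = 0 \<and> q3 = 1 \<or> p3 = 1 \<and> q3 = 0" "p4 = 0 \<and> q4 = 1 \<or> p4 = 1 \<and> q4 = 0"
    "p3' = 0 \<and> q3' = 1 \<or> p3' = 1 \<and> q3' = 0" "p4' = 0 \<and> q4' = 1 \<or> p4' = 1 \<and> q4' = 0"
    by (auto simp: defs defs' coupling_p_def coupling_q_def)
  have l: "l $ 1 > 0" "l $ 2 > 0" "l $ 3 > 0" "l $ 4 > 0" using pos by auto
  note compare = secular_comparison[where l = l and \<alpha> = \<alpha> and \<alpha>' = \<alpha>', OF indep common, folded defs defs']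
  note formulas = secular_form_def flow_derivative_def Let_def
  \<comment> \<open>At the angle \<open>y\<close> the factor belonging to edge 4 is nonzero in each of the four cases.\<close>
  define y where "y = pi / 4"
  have y: "cos y = sqrt 2 / 2" "sin y = sqrt 2 / 2" by (simp_all add: y_def cos_45 sin_45)
  obtain y2 y3 :: real where y23: "cos y2 * cos y3 = - 1 / 2" "sin y2 * cos y3 = - 1 / 2" "cos y2 * sin y3 = - 1 / 2"
      "sin (y2 + y3) = - 1" "cos (y2 + y3) = 0" "cos y2 \<noteq> 0" "cos y3 \<noteq> 0"
  proof (rule that[of y "y + pi"])
    show "cos y * cos (y + pi) = - 1 / 2" "sin y * cos (y + pi) = - 1 / 2"
      "cos y * sin (y + pi) = - 1 / 2"
      by (simp_all add: y)
    then show "sin (y + (y + pi)) = - 1" "cos (y + (y + pi)) = 0"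
      unfolding sin_add[of y "y + pi"] cos_add[of y "y + pi"] by (simp_all add: y)
  qed (simp_all add: y)
  have ex_arctan: "\<exists>x. sin x = m * cos x \<and> cos x \<noteq> 0" for m :: real
    by (rule exI[of _ "arctan m"]) (simp add: sin_arctan cos_arctan add_nonneg_eq_0_iff)
  have ne: "z \<noteq> 0" if "z = c * a \<or> z = - (c * a)" "c \<noteq> 0" "a > 0" for z c a :: real
    using that by auto
  \<comment> \<open>The four possible zeros have \<open>tan y4\<close> equal to \<open>- 2\<close>, \<open>1 / 2\<close>, \<open>\<infinity>\<close> and \<open>0\<close>, so each of them
    excludes the other three cases.\<close>
  have p: "p3' = p3 \<and> p4' = p4"
  proof -
    consider "p3 = 0" "q3 = 1" "p4 = 0" "q4 = 1" | "p3 = 0" "q3 = 1" "p4 = 1" "q4 = 0"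
      | "p3 = 1" "q3 = 0" "p4 = 0" "q4 = 1" | "p3 = 1" "q3 = 0" "p4 = 1" "q4 = 0"
      using pq by blast
    then show ?thesis
    proof cases
      case 1
      obtain y4 :: real where y4: "sin y4 = - 2 * cos y4" "cos y4 \<noteq> 0" using ex_arctan[of "- 2"] by auto
      have flow: "flow_derivative l p3 q3 p4 q4 0 y2 y3 y4 = - (cos y4 * (5 * l $ 4 + 2 * l $ 2 + 2 * l $ 3))"
        unfolding formulas y23 y4(1) by (simp add: 1 algebra_simps)
      have zero: "secular_form 0 0 p3 q3 p4 q4 0 y2 y3 y4 = 0"
        unfolding formulas by (simp add: 1 y23 y4(1))
      then have "secular_form 0 0 p3' q3' p4' q4' 0 y2 y3 y4 = 0"
        by (rule compare(1)[OF _ ne[OF disjI2, OF flow y4(2)] y23(6,7)]) (use l in simp)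
      then show ?thesis using pq(3,4) unfolding formulas by (auto simp: 1 y23 y4)
    next
      case 2
      obtain y4 :: real where "sin y4 = 1 / 2 * cos y4" "cos y4 \<noteq> 0" using ex_arctan[of "1 / 2"] by auto
      then have y4: "cos y4 = 2 * sin y4" "sin y4 \<noteq> 0" by simp_all
      have flow: "flow_derivative l p3 q3 p4 q4 0 y2 y3 y4 = - (sin y4 * (5 * l $ 4 + 2 * l $ 2 + 2 * l $ 3))"
        unfolding formulas y23 y4(1) by (simp add: 2 algebra_simps)
      have zero: "secular_form 0 0 p3 q3 p4 q4 0 y2 y3 y4 = 0"
        unfolding formulas by (simp add: 2 y23 y4(1))
      then have "secular_form 0 0 p3' q3' p4' q4' 0 y2 y3 y4 = 0"
        by (rule compare(1)[OF _ ne[OF disjI2, OF flow y4(2)] y23(6,7)]) (use l in simp)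
      then show ?thesis using pq(3,4) unfolding formulas by (auto simp: 2 y23 y4)
    next
      case 3
      have flow: "flow_derivative l p3 q3 p4 q4 0 y2 y3 (pi / 2) = - l $ 4"
        unfolding formulas by (simp add: 3 y23)
      have zero: "secular_form 0 0 p3 q3 p4 q4 0 y2 y3 (pi / 2) = 0"
        unfolding formulas by (simp add: 3 y23)
      then have "secular_form 0 0 p3' q3' p4' q4' 0 y2 y3 (pi / 2) = 0"
        by (rule compare(1)[OF _ _ y23(6,7)]) (use l in \<open>simp add: flow\<close>)
      then show ?thesis using pq(3,4) unfolding formulas by (auto simp: 3 y23)
    next
      case 4
      have flow: "flow_derivative l p3 q3 p4 q4 0 y2 y3 0 = l $ 4"
        unfolding formulas by (simp add: 4 y23)
      have zero: "secular_form 0 0 p3 q3 p4 q4 0 y2 y3 0 = 0"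
        unfolding formulas by (simp add: 4 y23)
      then have "secular_form 0 0 p3' q3' p4' q4' 0 y2 y3 0 = 0"
        by (rule compare(1)[OF _ _ y23(6,7)]) (use l in \<open>simp add: flow\<close>)
      then show ?thesis using pq(3,4) unfolding formulas by (auto simp: 4 y23)
    qed
  qed
  note first_order = compare(2)[OF _ _ _ _ p[THEN conjunct1] p[THEN conjunct2]]
  define V where "V = q3 * (q4 * sin y - p4 * cos y) - p3 * (q4 * cos y + p4 * sin y)"
  define W where "W = V + 2 * q3 * (q4 * cos y + p4 * sin y)"
  have VW: "V \<noteq> 0" "W \<noteq> 0" using pq(1,2) by (auto simp: V_def W_def y)
  have sum12: "(\<alpha> 1 - \<alpha>' 1) + (\<alpha> 2 - \<alpha>' 2) = 0"
  proof -
    have flow: "flow_derivative l p3 q3 p4 q4 0 0 pi y = - (V * (l $ 1 + l $ 2 + l $ 3))"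
      unfolding formulas V_def by (simp add: algebra_simps)
    have zero: "secular_form 0 0 p3 q3 p4 q4 0 0 pi y = 0" unfolding formulas by simp
    have "flow_derivative l p3 q3 p4 q4 0 0 pi y \<noteq> 0"
      by (rule ne[OF disjI2, OF flow VW(1)]) (use l in simp)
    from first_order[OF zero this] have "(\<alpha> 1 - \<alpha>' 1) * V + (\<alpha> 2 - \<alpha>' 2) * V = 0"
      unfolding secular_form_def Let_def by (simp add: V_def)
    then have "((\<alpha> 1 - \<alpha>' 1) + (\<alpha> 2 - \<alpha>' 2)) * V = 0" by (simp add: algebra_simps)
    then show ?thesis using VW by simp
  qed
  moreover have "5 * (\<alpha> 1 - \<alpha>' 1) + (\<alpha> 2 - \<alpha>' 2) = 0"
  proof -
    obtain y1 :: real where y1: "sin y1 = - 2 * cos y1" "cos y1 \<noteq> 0" using ex_arctan[of "- 2"] by auto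
    have flow: "flow_derivative l p3 q3 p4 q4 y1 y2 y3 y = - (cos y1 * W * (5 / 2 * l $ 1 + l $ 2 + l $ 3))"
      unfolding formulas V_def W_def y23 y1(1) by (simp add: algebra_simps)
    have zero: "secular_form 0 0 p3 q3 p4 q4 y1 y2 y3 y = 0"
      unfolding formulas y23 y1(1) by (simp add: algebra_simps)
    have "cos y1 * W \<noteq> 0" using y1(2) VW(2) by simp
    have "flow_derivative l p3 q3 p4 q4 y1 y2 y3 y \<noteq> 0"
      by (rule ne[OF disjI2, OF flow \<open>cos y1 * W \<noteq> 0\<close>]) (use l in simp)
    note first_order[OF zero this y23(6,7)]
    moreover have "secular_form 1 0 p3 q3 p4 q4 y1 y2 y3 y = 5 / 2 * cos y1 * W"
      "secular_form 0 1 p3 q3 p4 q4 y1 y2 y3 y = 1 / 2 * cos y1 * W"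
      "secular_form 0 0 p3 r p4 r' y1 y2 y3 y = 0" for r r'
      unfolding secular_form_def Let_def V_def W_def y23 y1(1) by (simp_all add: algebra_simps)
    ultimately have "(\<alpha> 1 - \<alpha>' 1) * (5 / 2 * cos y1 * W) + (\<alpha> 2 - \<alpha>' 2) * (1 / 2 * cos y1 * W) = 0"
      by simp
    then have "(5 * (\<alpha> 1 - \<alpha>' 1) + (\<alpha> 2 - \<alpha>' 2)) * (cos y1 * W) = 0" by (simp add: field_simps)
    then show ?thesis using VW y1 by simp
  qed
  moreover have "a = 0" if "a + b = 0" "5 * a + b = 0" for a b :: real using that by linarith
  ultimately have "\<alpha> 1 - \<alpha>' 1 = 0" by blast
  with sum12 have eq12: "\<alpha> 1 = \<alpha>' 1" "\<alpha> 2 = \<alpha>' 2" by simp_all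
  \<comment> \<open>With equal \<open>p3\<close>, the reciprocals differ only if both coupling constants are nonzero.\<close>
  have eq3: "1 / \<alpha> 3 = 1 / \<alpha>' 3"
  proof (cases "p3 = 0")
    case True
    then show ?thesis using p by (auto simp: p3_def p3'_def coupling_p_def split: if_splits)
  next
    case False
    then have pq3: "p3 = 1" "q3 = 0" using pq by auto
    have flow: "flow_derivative l p3 q3 p4 q4 0 0 0 y = V * (l $ 1 + l $ 2 + l $ 3)"
      unfolding formulas V_def by (simp add: pq3 algebra_simps)
    have zero: "secular_form 0 0 p3 q3 p4 q4 0 0 0 y = 0" unfolding formulas by (simp add: pq3)
    have "flow_derivative l p3 q3 p4 q4 0 0 0 y \<noteq> 0"
      by (rule ne[OF disjI1, OF flow VW(1)]) (use l in simp)
    from first_order[OF zero this] have "(1 / \<alpha> 3 - 1 / \<alpha>' 3) * (4 * V) = 0"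
      unfolding secular_form_def Let_def eq12 by (simp add: V_def pq3 algebra_simps)
    then show ?thesis using VW by simp
  qed
  have eq4: "1 / \<alpha> 4 = 1 / \<alpha>' 4"
  proof (cases "p4 = 0")
    case True
    then show ?thesis using p by (auto simp: p4_def p4'_def coupling_p_def split: if_splits)
  next
    case False
    then have pq4: "p4 = 1" "q4 = 0" using pq by auto
    from pq(1) show ?thesis
    proof
      assume pq3: "p3 = 0 \<and> q3 = 1"
      have flow: "flow_derivative l p3 q3 p4 q4 (pi / 2) 0 pi (pi / 2) = - (l $ 2 + l $ 3 + l $ 4)"
        unfolding formulas by (simp add: pq3 pq4)
      have zero: "secular_form 0 0 p3 q3 p4 q4 (pi / 2) 0 pi (pi / 2) = 0"
        unfolding formulas by (simp add: pq3 pq4)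
      from first_order[OF zero] l show ?thesis
        unfolding flow secular_form_def Let_def eq12 eq3 by (simp add: pq3 pq4)
    next
      assume pq3: "p3 = 1 \<and> q3 = 0"
      have flow: "flow_derivative l p3 q3 p4 q4 (pi / 2) 0 pi 0 = l $ 4"
        unfolding formulas by (simp add: pq3 pq4)
      have zero: "secular_form 0 0 p3 q3 p4 q4 (pi / 2) 0 pi 0 = 0"
        unfolding formulas by (simp add: pq3 pq4)
      from first_order[OF zero] l show ?thesis
        unfolding flow secular_form_def Let_def eq12 eq3 by (simp add: pq3 pq4)
    qed
  qed
  show ?thesis
    using eq12 eq3 eq4 by simp
qed

section \<open>The graph and its coupling constants\<close>

text \<open>
  Each of the eight endpoints lies in exactly one vertex, and the joins place all eight; so they
  determine the vertices as sets.
\<close>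

lemma double_edge_path_from_joins:
  assumes G: "metric_graph G" and edges: "num_edges G = 4" and vertices: "num_vertices G = 4"
    and joins: "joins G 1 1 2" "joins G 2 2 3" "joins G 3 2 3" "joins G 4 3 4"
    and types: "vertex_type G 1 = Delta" "vertex_type G 2 = Delta"
      "vertex_type G 3 = DeltaPrime" "vertex_type G 4 = DeltaPrime"
  obtains e e' where "double_edge_path G e e'"
proof -
  define u v :: "nat \<Rightarrow> nat" where "u = (\<lambda>j. if j = 1 then 1 else if j = 4 then 3 else 2)"
    and "v = (\<lambda>j. if j = 1 then 2 else if j = 4 then 4 else 3)"
  have four: "j = 1 \<or> j = 2 \<or> j = 3 \<or> j = 4" if "j \<in> {1..4}" for j :: nat
    using that by auto
  have "\<forall>j\<in>{1..4}. \<exists>i i'. ends_of_edge j i i' \<and> i \<in> vertex G (u j) \<and> i' \<in> vertex G (v j)"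
  proof
    fix j :: nat assume "j \<in> {1..4}"
    then have "joins G j (u j) (v j)" using joins four[of j] by (auto simp: u_def v_def)
    then show "\<exists>i i'. ends_of_edge j i i' \<and> i \<in> vertex G (u j) \<and> i' \<in> vertex G (v j)"
      unfolding joins_def ends_of_edge_def by blast
  qed
  from bchoice[OF this] obtain e where
    "\<forall>j\<in>{1..4}. \<exists>i'. ends_of_edge j (e j) i' \<and> e j \<in> vertex G (u j) \<and> i' \<in> vertex G (v j)" ..
  from bchoice[OF this] obtain e' where ee': "\<forall>j\<in>{1..4}.
      ends_of_edge j (e j) (e' j) \<and> e j \<in> vertex G (u j) \<and> e' j \<in> vertex G (v j)" ..
  have part: "partition_on {1..8} (vertex G ` {1..4})" and inj: "inj_on (vertex G) {1..4}"
    using G edges vertices by (auto simp: metric_graph_def)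
  have unique: "m = m'" if "i \<in> vertex G m" "i \<in> vertex G m'" "m \<in> {1..4}" "m' \<in> {1..4}" for i m m'
  proof (rule ccontr)
    assume "m \<noteq> m'"
    then have "vertex G m \<noteq> vertex G m'" using inj that by (auto simp: inj_on_def)
    then have "disjnt (vertex G m) (vertex G m')"
      using partition_onD2[OF part] that(3,4) by (auto simp: pairwise_def)
    then show False using that(1,2) by (auto simp: disjnt_def)
  qed
  have cover: "\<exists>j\<in>{1..4}. i = e j \<and> m = u j \<or> i = e' j \<and> m = v j"
    if "i \<in> vertex G m" "m \<in> {1..4}" for i m
  proof -
    have i: "i \<in> {1..8}" using partition_onD1[OF part] that by auto
    define j where "j = (i + 1) div 2"
    have j: "j \<in> {1..4}" "i = 2 * j - 1 \<or> i = 2 * j" using i by (auto simp: j_def)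
    have "ends_of_edge j (e j) (e' j)" using ee' j(1) by blast
    then have "i = e j \<or> i = e' j" using j(2) by (auto simp: ends_of_edge_def)
    moreover have "u j \<in> {1..4}" "v j \<in> {1..4}" by (auto simp: u_def v_def)
    ultimately show ?thesis using unique[OF that(1) _ that(2)] ee' j(1) by blast
  qed
  have V: "vertex G m = {i. \<exists>j\<in>{1..4}. i = e j \<and> m = u j \<or> i = e' j \<and> m = v j}"
    if "m \<in> {1..4}" for m
    using cover[OF _ that] ee' by blast
  have indices: "{1..4::nat} = {1, 2, 3, 4}" by auto
  have "vertex G 1 = {e 1}" "vertex G 2 = {e' 1, e 2, e 3}"
    "vertex G 3 = {e' 2, e' 3, e 4}" "vertex G 4 = {e' 4}"
    using V[of 1] V[of 2] V[of 3] V[of 4] unfolding indices by (auto simp: u_def v_def)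
  moreover have "\<forall>j\<in>{1..4}. ends_of_edge j (e j) (e' j)" using ee' by blast
  ultimately have "double_edge_path G e e'"
    unfolding double_edge_path_def using G edges vertices types by blast
  then show thesis by (rule that)
qed

theorem proposition5p2:
  fixes G :: marked_graph and \<alpha> \<alpha>' :: "nat \<Rightarrow> real"
  assumes "metric_graph G"
    and "num_edges G = 4" and "num_vertices G = 4"
    and "joins G 1 1 2" and "joins G 2 2 3" and "joins G 3 2 3" and "joins G 4 3 4"
    and "vertex_type G 1 = Delta" and "vertex_type G 2 = Delta"
    and "vertex_type G 3 = DeltaPrime" and "vertex_type G 4 = DeltaPrime"
    and "rationally_independent {1..4} (edge_length G)"
    and "isospectral G \<alpha> \<alpha>'"
  shows "\<forall>k\<in>{1..4}. \<alpha> k = \<alpha>' k"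
proof -
  note G = assms(1) and edges = assms(2) and independent = assms(12) and iso = assms(13)
  obtain e e' where path: "double_edge_path G e e'"
    using double_edge_path_from_joins[OF assms(1-11)] .
  define l where "l = point (edge_length G 1) (edge_length G 2) (edge_length G 3) (edge_length G 4)"
  have common: "secular \<alpha>' (1 / k) (k *\<^sub>R l) = 0"
    if k: "k > 0" "cos (k * l $ 2) \<noteq> 0" "cos (k * l $ 3) \<noteq> 0" "secular \<alpha> (1 / k) (k *\<^sub>R l) = 0" for k
  proof -
    have iff: "(\<exists>f\<in>eigenspace G \<beta> (of_real (k\<^sup>2)). f \<noteq> 0) \<longleftrightarrow> secular \<beta> (1 / k) (k *\<^sub>R l) = 0" for \<beta>
      using eigenvalue_iff_secular_zero[OF path, of k \<beta>] k(1-3) by (simp add: secular_def l_def)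
    obtain f where "f \<in> eigenspace G \<alpha> (of_real (k\<^sup>2))" "f \<noteq> 0" using iff[of \<alpha>] k(4) by blast
    from isospectral_eigenfunction[OF G k(1) iso this]
    obtain g where "g \<in> eigenspace G \<alpha>' (of_real (k\<^sup>2))" "g \<noteq> 0" .
    then show ?thesis using iff[of \<alpha>'] by blast
  qed
  have pos: "l $ i > 0" for i
  proof -
    have "edge_length G j > 0" if "j \<in> {1..4}" for j
      using edge_endpoints_less[OF G, of j] that edges by (simp add: edge_length_def)
    then have "\<forall>i. l $ i > 0" unfolding forall_4 by (simp add: l_def)
    then show ?thesis ..
  qed
  have indep: "\<forall>i. q i = 0" if q: "(\<Sum>i\<in>UNIV. of_int (q i) * l $ i) = 0" for q :: "4 \<Rightarrow> int"
  proof -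
    define r :: "nat \<Rightarrow> rat" where "r = (\<lambda>j. of_int (q (of_nat j)))"
    have four: "{1..4::nat} = {1, 2, 3, 4}" by auto
    have "(\<Sum>j\<in>{1..4}. of_rat (r j) * edge_length G j) = 0"
      using q unfolding four sum_4 by (simp add: r_def l_def)
    then have "\<forall>j\<in>{1..4}. r j = 0"
      using independent by (auto simp: rationally_independent_def)
    then have "r 1 = 0" "r 2 = 0" "r 3 = 0" "r 4 = 0" by auto
    then show ?thesis unfolding forall_4 by (simp add: r_def)
  qed
  have "\<alpha> 1 = \<alpha>' 1 \<and> \<alpha> 2 = \<alpha>' 2 \<and> \<alpha> 3 = \<alpha>' 3 \<and> \<alpha> 4 = \<alpha>' 4"
  proof (rule coupling_constants_determined)
    show "\<forall>q :: 4 \<Rightarrow> int. (\<Sum>i\<in>UNIV. of_int (q i) * l $ i) = 0 \<longrightarrow> (\<forall>i. q i = 0)"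
      by (rule allI, rule impI, rule indep)
    show "\<forall>k>0. cos (k * l $ 2) \<noteq> 0 \<and> cos (k * l $ 3) \<noteq> 0 \<and>
        secular \<alpha> (1 / k) (k *\<^sub>R l) = 0 \<longrightarrow> secular \<alpha>' (1 / k) (k *\<^sub>R l) = 0"
      using common by simp
  qed (rule pos)
  moreover have "{1..4::nat} = {1, 2, 3, 4}" by auto
  ultimately show ?thesis by simp
qed

end
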